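(* Consider the 1G$n$B system with parameters $n,p_{\mathrm{gen}},p_{\mathrm{con}},q,\Gamma,F_{\mathrm{new}}$ and policy coefficients $(a_k,b_k,c_k,d_k)_{k=1}^n$. Let $T_{\mathrm{occ}}$ be the time from when memory G becomes occupied until it is emptied (by consumption or failed purification), and $T_{\mathrm{gen}}$ the time from when G is emptied until it is next occupied by a newly generated link. Then the availability satisfies $$A=\frac{\mathbb E[T_{\mathrm{occ}}]}{\mathbb E[T_{\mathrm{gen}}]+\mathbb E[T_{\mathrm{occ}}]}\quad\text{almost surely},$$ where $$\mathbb E[T_{\mathrm{gen}}]=\frac{1}{1-(1-p_{\mathrm{gen}})^n},\qquad \mathbb E[T_{\mathrm{occ}}]=\frac{1-\tilde A+\tilde C\,(F_{\mathrm{new}}-\frac14)}{\big[(1-\tilde A)(1-\tilde D)-\tilde B\tilde C\big]\tilde P},$$ with $$\tilde P=p_{\mathrm{con}}+q\big(1-(1-p_{\mathrm{gen}})^n\big)(1-p_{\mathrm{con}}),$$ $$\tilde A=\frac{q(1-p_{\mathrm{con}})\tilde a}{e^{\Gamma}-(1-q+q(1-p_{\mathrm{gen}})^n)(1-p_{\mathrm{con}})},\qquad \tilde B=\frac{q(1-p_{\mathrm{con}})\tilde b}{p_{\mathrm{con}}+q(1-(1-p_{\mathrm{gen}})^n)(1-p_{\mathrm{con}})},$$ $$\tilde C=\frac{q(1-p_{\mathrm{con}})\tilde c}{e^{\Gamma}-(1-q+q(1-p_{\mathrm{gen}})^n)(1-p_{\mathrm{con}})},\qquad \tilde D=\frac{q(1-p_{\mathrm{con}})\tilde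 d}{p_{\mathrm{con}}+q(1-(1-p_{\mathrm{gen}})^n)(1-p_{\mathrm{con}})},$$ and $\tilde a=\sum_{k=1}^n a_k\binom nk(1-p_{\mathrm{gen}})^{n-k}p_{\mathrm{gen}}^k$, and $\tilde b,\tilde c,\tilde d$ defined by the same formula with $a_k$ replaced by $b_k,c_k,d_k$ respectively.
   Context: Model (1G$n$B system). Parameters: an integer $n\ge1$; $p_{\mathrm{gen}}\in(0,1]$; $p_{\mathrm{con}}\in(0,1]$; $q\in[0,1]$; $\Gamma\ge0$; $F_{\mathrm{new}}\in(1/4,1]$; and, for $k=1,\dots,n$, real constants $a_k,b_k,c_k,d_k$ (the purification policy). Put $p_k(F)=c_k(F-\frac14)+d_k$ (success probability) and $J_k(F)=\frac14+\frac{a_k(F-1/4)+b_k}{c_k(F-1/4)+d_k}$ (jump function). Physicality: for all $F\in[1/4,1]$, $0\le p_k(F)\le1$ and $0\le a_k(F-\frac14)+b_k\le\frac34p_k(F)$ (i.e. $J_k(F)\in[1/4,1]$ when $p_k(F)>0$). Dynamics. For $t=1,2,\dots$ let $X_t\sim\mathrm{Bernoulli}(p_{\mathrm{con}})$ (a consumption request arrives at time $t$), $K_t\sim\mathrm{Bin}(n,p_{\mathrm{gen}})$ (number of links generated), $Q_t\sim\mathrm{Bernoulli}(q)$ (decision to purify), $W_t\sim\mathrm{Unif}[0,1]$, all independent. $F(t)$ is the fidelity of the link stored in memory G at time $t$, with $F(t)=0$ meaning that G is empty; $F(0)=F_{\mathrm{new}}$. For $t\ge1$ let $F^-(t)=e^{-\Gamma}(F(t-1)-\frac14)+\frac14$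 if $F(t-1)>0$ and $F^-(t)=0$ if $F(t-1)=0$. If $F(t-1)=0$, then $F(t)=F_{\mathrm{new}}$ if $K_t\ge1$ and $F(t)=0$ otherwise (a request, if any, is discarded). If $F(t-1)>0$: when $X_t=1$ the link is consumed, $F(t)=0$; when $X_t=0$, $K_t\ge1$, $Q_t=1$, purification is attempted, and with $k=K_t$, $F(t)=J_k(F^-(t))$ if $W_t<p_k(F^-(t))$ (success) and $F(t)=0$ otherwise (failure); in all remaining cases $F(t)=F^-(t)$. Let $T^{(j)}_{\mathrm{con}}$ be the $j$-th time $t\ge1$ with $X_t=1$. The availability is $A=\lim_{m\to\infty}\frac1m\sum_{j=1}^m\mathbb 1\{F^-(T^{(j)}_{\mathrm{con}})>0\}$. *)

theory Defs
  imports "HOL-Probability.Probability"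
begin

definition success_prob :: "(nat \<Rightarrow> real) \<Rightarrow> (nat \<Rightarrow> real) \<Rightarrow> nat \<Rightarrow> real \<Rightarrow> real" where
  "success_prob c d k x = c k * (x - 1/4) + d k"

definition jump ::
    "(nat \<Rightarrow> real) \<Rightarrow> (nat \<Rightarrow> real) \<Rightarrow> (nat \<Rightarrow> real) \<Rightarrow> (nat \<Rightarrow> real) \<Rightarrow> nat \<Rightarrow> real \<Rightarrow> real" where
  "jump a b c d k x = 1/4 + (a k * (x - 1/4) + b k) / (c k * (x - 1/4) + d k)"

text \<open>Fidelity 0 encodes an empty memory; it is never reached by decoherence.\<close>

definition decohere :: "real \<Rightarrow> real \<Rightarrow> real" where
  "decohere \<Gamma> x = (if x > 0 then exp (- \<Gamma>) * (x - 1/4) + 1/4 else 0)"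

text \<open>One time step from memory content \<open>x\<close>, given whether a request arrives (\<open>r\<close>), the number
  \<open>k\<close> of generated links, the decision \<open>u\<close> whether to purify, and the uniform sample \<open>w\<close>.\<close>

definition memory_step ::
    "(nat \<Rightarrow> real) \<Rightarrow> (nat \<Rightarrow> real) \<Rightarrow> (nat \<Rightarrow> real) \<Rightarrow> (nat \<Rightarrow> real) \<Rightarrow> real \<Rightarrow> real
     \<Rightarrow> bool \<Rightarrow> nat \<Rightarrow> bool \<Rightarrow> real \<Rightarrow> real \<Rightarrow> real" where
  "memory_step a b c d \<Gamma> F_new r k u w x =
     (if x = 0 then (if k \<ge> 1 then F_new else 0)
      else if r then 0
      else if k \<ge> 1 \<and> u then
        (if w < success_prob c d k (decohere \<Gamma> x) then jump a b c d k (decohere \<Gamma> x) else 0)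
      else decohere \<Gamma> x)"

datatype source = Request | Generation | Decision | Purification

text \<open>The driving variables have different types, so their joint independence is stated for their
  injective images in the reals; these generate the same sigma-algebras.\<close>

locale link_1GnB = prob_space M
  for M :: "'a measure" +
  fixes n :: nat and p_gen p_con q \<Gamma> F_new :: real
    and a b c d :: "nat \<Rightarrow> real"
    and X :: "nat \<Rightarrow> 'a \<Rightarrow> bool" and K :: "nat \<Rightarrow> 'a \<Rightarrow> nat"
    and Q :: "nat \<Rightarrow> 'a \<Rightarrow> bool" and W :: "nat \<Rightarrow> 'a \<Rightarrow> real"
    and F :: "nat \<Rightarrow> 'a \<Rightarrow> real"
  assumes n_ge_1: "n \<ge> 1"
    and p_gen: "0 < p_gen" "p_gen \<le> 1"
    and p_con: "0 < p_con" "p_con \<le> 1"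
    and q: "0 \<le> q" "q \<le> 1"
    and \<Gamma>: "\<Gamma> \<ge> 0"
    and F_new: "1/4 < F_new" "F_new \<le> 1"
    and physical_prob: "\<And>k x. k \<in> {1..n} \<Longrightarrow> x \<in> {1/4..1} \<Longrightarrow>
      0 \<le> success_prob c d k x \<and> success_prob c d k x \<le> 1"
    and physical_jump: "\<And>k x. k \<in> {1..n} \<Longrightarrow> x \<in> {1/4..1} \<Longrightarrow>
      0 \<le> a k * (x - 1/4) + b k \<and> a k * (x - 1/4) + b k \<le> 3/4 * success_prob c d k x"
    and X_measurable: "\<And>t. t \<ge> 1 \<Longrightarrow> X t \<in> measurable M (count_space UNIV)"
    and K_measurable: "\<And>t. t \<ge> 1 \<Longrightarrow> K t \<in> measurable M (count_space UNIV)"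
    and Q_measurable: "\<And>t. t \<ge> 1 \<Longrightarrow> Q t \<in> measurable M (count_space UNIV)"
    and W_measurable: "\<And>t. t \<ge> 1 \<Longrightarrow> W t \<in> borel_measurable M"
    and X_law: "\<And>t. t \<ge> 1 \<Longrightarrow>
      distr M (count_space UNIV) (X t) = measure_pmf (bernoulli_pmf p_con)"
    and K_law: "\<And>t. t \<ge> 1 \<Longrightarrow>
      distr M (count_space UNIV) (K t) = measure_pmf (binomial_pmf n p_gen)"
    and Q_law: "\<And>t. t \<ge> 1 \<Longrightarrow>
      distr M (count_space UNIV) (Q t) = measure_pmf (bernoulli_pmf q)"
    and W_law: "\<And>t. t \<ge> 1 \<Longrightarrow> distr M borel (W t) = uniform_measure lborel {0..1}"
    and indep: "indep_vars (\<lambda>_. borel)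
      (\<lambda>(s, t) \<omega>. case s of
           Request \<Rightarrow> of_bool (X t \<omega>)
         | Generation \<Rightarrow> real (K t \<omega>)
         | Decision \<Rightarrow> of_bool (Q t \<omega>)
         | Purification \<Rightarrow> W t \<omega>)
      (UNIV \<times> {1..})"
    and F_0: "\<And>\<omega>. \<omega> \<in> space M \<Longrightarrow> F 0 \<omega> = F_new"
    and F_step: "\<And>t \<omega>. \<omega> \<in> space M \<Longrightarrow> t \<ge> 1 \<Longrightarrow>
      F t \<omega> = memory_step a b c d \<Gamma> F_new (X t \<omega>) (K t \<omega>) (Q t \<omega>) (W t \<omega>) (F (t - 1) \<omega>)"

text \<open>Cycles of a sample path \<open>f\<close> that starts occupied: cycle \<open>i\<close> (counted from 0) begins at
  \<open>occupied_at f i\<close>, the memory is next emptied at \<open>emptied_at f i\<close>, and the cycle ends when the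
  memory is occupied again.  The values are meaningful for all \<open>i\<close> if \<open>f\<close> is infinitely often
  zero and infinitely often positive.\<close>

definition next_time :: "(nat \<Rightarrow> bool) \<Rightarrow> nat \<Rightarrow> nat" where
  "next_time P s = (LEAST t. s < t \<and> P t)"

primrec occupied_at :: "(nat \<Rightarrow> real) \<Rightarrow> nat \<Rightarrow> nat" where
  "occupied_at f 0 = 0"
| "occupied_at f (Suc i) =
     next_time (\<lambda>t. f t > 0) (next_time (\<lambda>t. f t = 0) (occupied_at f i))"

definition emptied_at :: "(nat \<Rightarrow> real) \<Rightarrow> nat \<Rightarrow> nat" where
  "emptied_at f i = next_time (\<lambda>t. f t = 0) (occupied_at f i)"

definition T_occ :: "(nat \<Rightarrow> 'a \<Rightarrow> real) \<Rightarrow> nat \<Rightarrow> 'a \<Rightarrow> nat" where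
  "T_occ F i \<omega> = emptied_at (\<lambda>t. F t \<omega>) i - occupied_at (\<lambda>t. F t \<omega>) i"

definition T_gen :: "(nat \<Rightarrow> 'a \<Rightarrow> real) \<Rightarrow> nat \<Rightarrow> 'a \<Rightarrow> nat" where
  "T_gen F i \<omega> = occupied_at (\<lambda>t. F t \<omega>) (Suc i) - emptied_at (\<lambda>t. F t \<omega>) i"

text \<open>The \<open>j\<close>-th request, \<open>j \<ge> 1\<close>; \<open>enumerate\<close> counts from 0.\<close>

definition T_con :: "(nat \<Rightarrow> 'a \<Rightarrow> bool) \<Rightarrow> nat \<Rightarrow> 'a \<Rightarrow> nat" where
  "T_con X j \<omega> = enumerate {t. t \<ge> 1 \<and> X t \<omega>} (j - 1)"

definition F_minus :: "real \<Rightarrow> (nat \<Rightarrow> 'a \<Rightarrow> real) \<Rightarrow> nat \<Rightarrow> 'a \<Rightarrow> real" where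
  "F_minus \<Gamma> F t \<omega> = decohere \<Gamma> (F (t - 1) \<omega>)"

definition served_fraction ::
    "real \<Rightarrow> (nat \<Rightarrow> 'a \<Rightarrow> real) \<Rightarrow> (nat \<Rightarrow> 'a \<Rightarrow> bool) \<Rightarrow> 'a \<Rightarrow> nat \<Rightarrow> real" where
  "served_fraction \<Gamma> F X \<omega> m =
     1 / real m * (\<Sum>j = 1..m. of_bool (F_minus \<Gamma> F (T_con X j \<omega>) \<omega> > 0))"

definition availability ::
    "real \<Rightarrow> (nat \<Rightarrow> 'a \<Rightarrow> real) \<Rightarrow> (nat \<Rightarrow> 'a \<Rightarrow> bool) \<Rightarrow> 'a \<Rightarrow> real" where
  "availability \<Gamma> F X \<omega> = lim (served_fraction \<Gamma> F X \<omega>)"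

definition binomial_average :: "nat \<Rightarrow> real \<Rightarrow> (nat \<Rightarrow> real) \<Rightarrow> real" where
  "binomial_average n p v =
     (\<Sum>k = 1..n. v k * real (n choose k) * (1 - p) ^ (n - k) * p ^ k)"

end

theory Submission
  imports Defs
begin

text \<open>
  Write \<open>z = F(t) - 1/4\<close>.  While the memory is occupied, one time step acts linearly on the pair
  \<open>(P(occupied), E[z; occupied])\<close>, because \<open>p\<^sub>k (J\<^sub>k - 1/4)\<close> and \<open>p\<^sub>k\<close> are affine in \<open>z\<close>.  Hence the
  expected remaining occupancy time is an affine function \<open>h\<close> of \<open>z\<close>, found by inverting a \<open>2 \<times> 2\<close>
  matrix whose determinant is positive by physicality.

  The same \<open>h\<close>, set to 0 on the empty memory and multiplied by the fraction of idle time, solves the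
  Poisson equation for the indicator of an occupied memory.  Thus that indicator, minus its stationary
  mean, is a bounded martingale difference up to a telescoping term, and its time average converges by
  a strong law for bounded orthogonal variables (Chebyshev along the squares, then interpolation).
  A request at time \<open>t\<close> is independent of the memory content at time \<open>t - 1\<close>, so the same strong law
  shows that requests see time averages.

  The means of \<open>T_occ\<close> and \<open>T_gen\<close> in the \<open>i\<close>-th cycle come from summing, over \<open>t\<close>, the one-step
  recursion for \<open>h\<close> and for the probability that cycle \<open>i\<close> is in progress at time \<open>t\<close>; no independence
  of the cycles is needed.
\<close>

section \<open>A strong law for bounded orthogonal variables\<close>

text \<open>The cycles are not treated as a renewal sequence: their independence would need a strong
  Markov property at the random times \<open>occupied_at\<close>. All probability takes place at
  fixed times, through \<open>expectation_step\<close>, a Markov property integrated against a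
  bounded variable of the past. That test variable is an earlier martingale difference in the strong
  law, and an indicator of a cycle number in the computation of the means.

  Purification brings in the only event that mixes a fresh draw with the past, \<open>W < p\<close>
  with \<open>p\<close> depending on the stored fidelity; hence the separate treatment of a uniform
  threshold. Physicality also covers p_k = 0, where the quotient in J_k is a default value. It
  speaks only of 1 <= k <= n and 1/4 <= F <= 1, and the laws of \<open>K\<close> and
  \<open>W\<close> keep a path in this range only almost surely; \<open>regular\<close> singles out
  the good paths.

  The tilde constants of the theorem belong to the memory watched at purification attempts, not at
  single steps; \<open>mean_occ_formula\<close> converts between the two.\<close>

lemma average_tendsto_0_from_squares:
  fixes x :: "nat \<Rightarrow> real"
  assumes bound: "\<And>t. \<bar>x t\<bar> \<le> c"
    and sq: "(\<lambda>k. (\<Sum>t<(Suc k)\<^sup>2. x t) / real ((Suc k)\<^sup>2)) \<longlonglongrightarrow> 0"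
  shows "(\<lambda>N. (\<Sum>t<N. x t) / real N) \<longlonglongrightarrow> 0"
proof -
  define S where "S N = (\<Sum>t<N. x t)" for N
  \<comment> \<open>For N >= 1, \<open>Suc (r N)\<close> is the integer part of the square root of
    N; the predecessor matches the indexing of the squares by \<open>Suc k\<close>.\<close>
  define r where "r N = nat \<lfloor>sqrt (real N)\<rfloor> - 1" for N
  have c0: "0 \<le> c" using bound[of 0] by linarith
  have rlim: "filterlim r at_top at_top"
    unfolding r_def filterlim_at_top
  proof
    fix Z
    show "eventually (\<lambda>N. Z \<le> nat \<lfloor>sqrt (real N)\<rfloor> - 1) at_top"
      using eventually_ge_at_top[of "(Suc Z)\<^sup>2"]
    proof eventually_elim
      case (elim N)
      have "real (Suc Z) \<le> sqrt (real N)"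
        using elim by (metis of_nat_le_iff of_nat_power real_le_rsqrt)
      thus ?case by linarith
    qed
  qed
  have near: "\<bar>S N / real N\<bar> \<le> \<bar>S ((Suc (r N))\<^sup>2) / real ((Suc (r N))\<^sup>2)\<bar> + 3 * c / real (Suc (r N))"
    if N: "N \<ge> 1" for N
  proof -
    define k where "k = Suc (r N)"
    have "sqrt (real N) \<ge> 1" using N by simp
    hence k: "k = nat \<lfloor>sqrt (real N)\<rfloor>" unfolding k_def r_def by linarith
    have k1: "k \<ge> 1" by (simp add: k_def)
    have "real k \<le> sqrt (real N)" "sqrt (real N) < real k + 1"
      using k k1 by linarith+
    hence le: "(real k)\<^sup>2 \<le> real N" and lt: "real N < (real k + 1)\<^sup>2"
      by (metis of_nat_0_le_iff power_mono real_sqrt_pow2)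
         (metis \<open>sqrt (real N) < real k + 1\<close> of_nat_0_le_iff power_strict_mono real_sqrt_ge_0_iff real_sqrt_pow2 zero_less_numeral)
    have le': "k\<^sup>2 \<le> N" using le by (metis of_nat_le_iff of_nat_power)
    \<comment> \<open>At most 2 k terms lie strictly past k^2 and before the next square, so they
      add O(k) to a sum that is divided by at least k^2.\<close>
    have diff: "real N - real (k\<^sup>2) \<le> 3 * real k"
    proof -
      have "real N < real ((k+1)^2)" using lt by (simp add: add.commute)
      hence "N < (k+1)^2" by linarith
      hence "N \<le> k^2 + 2 * k" by (simp add: power2_eq_square)
      hence "real N \<le> real (k^2 + 2 * k)" by (simp only: of_nat_le_iff)
      thus ?thesis by simp
    qed
    have "S N = S (k\<^sup>2) + (\<Sum>t\<in>{k\<^sup>2..<N}. x t)"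
      unfolding S_def using le' by (metis atLeast0LessThan le0 sum.atLeastLessThan_concat)
    moreover have "\<bar>\<Sum>t\<in>{k\<^sup>2..<N}. x t\<bar> \<le> (\<Sum>t\<in>{k\<^sup>2..<N}. c)"
      by (intro order.trans[OF sum_abs] sum_mono bound)
    moreover have "(\<Sum>t\<in>{k\<^sup>2..<N}. c) \<le> 3 * real k * c"
      using diff le' c0 by (simp add: of_nat_diff mult_right_mono)
    ultimately have "\<bar>S N\<bar> \<le> \<bar>S (k\<^sup>2)\<bar> + 3 * real k * c" by linarith
    hence "\<bar>S N\<bar> / real N \<le> (\<bar>S (k\<^sup>2)\<bar> + 3 * real k * c) / real N"
      by (simp add: divide_right_mono)
    also have "\<dots> \<le> (\<bar>S (k\<^sup>2)\<bar> + 3 * real k * c) / real (k\<^sup>2)"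
      using le' k1 c0 N by (intro divide_left_mono mult_pos_pos) (auto simp flip: of_nat_power)
    also have "\<dots> = \<bar>S (k\<^sup>2)\<bar> / real (k\<^sup>2) + 3 * c / real k"
      using k1 by (simp add: field_simps power2_eq_square)
    finally show ?thesis by (simp add: k_def)
  qed
  have "(\<lambda>k. \<bar>S ((Suc k)\<^sup>2) / real ((Suc k)\<^sup>2)\<bar> + 3 * c / real (Suc k)) \<longlonglongrightarrow> 0 + 0"
    using sq unfolding S_def
    by (intro tendsto_add tendsto_rabs_zero LIMSEQ_Suc[OF lim_const_over_n])
  from filterlim_compose[OF this[simplified] rlim]
  have lim: "(\<lambda>N. \<bar>S ((Suc (r N))\<^sup>2) / real ((Suc (r N))\<^sup>2)\<bar> + 3 * c / real (Suc (r N))) \<longlonglongrightarrow> 0"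
    by simp
  have "(\<lambda>N. S N / real N) \<longlonglongrightarrow> 0"
    by (rule Lim_null_comparison[OF _ lim])
       (use near in \<open>auto intro!: eventually_sequentiallyI[of 1]\<close>)
  thus ?thesis by (simp add: S_def)
qed

text \<open>Orthogonality leaves only the diagonal of E[S_N^2], which is at most c^2 N. Along N =
  (k+1)^2 the squared averages have summable means, so by monotone convergence their sum is finite
  almost surely and they tend to 0. Bounded terms then allow interpolation between squares.\<close>

lemma (in prob_space) orthogonal_average_tendsto_0:
  fixes D :: "nat \<Rightarrow> 'a \<Rightarrow> real"
  assumes D [measurable]: "\<And>t. D t \<in> borel_measurable M"
    and bound: "\<And>t. AE \<omega> in M. \<bar>D t \<omega>\<bar> \<le> c"
    and orth: "\<And>s t. s < t \<Longrightarrow> expectation (\<lambda>\<omega>. D s \<omega> * D t \<omega>) = 0"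
  shows "AE \<omega> in M. (\<lambda>N. (\<Sum>t<N. D t \<omega>) / real N) \<longlonglongrightarrow> 0"
proof -
  define S where "S N \<omega> = (\<Sum>t<N. D t \<omega>)" for N \<omega>
  have [measurable]: "S N \<in> borel_measurable M" for N unfolding S_def by measurable
  have ae: "AE \<omega> in M. \<forall>t. \<bar>D t \<omega>\<bar> \<le> c" using bound by (simp add: AE_all_countable)
  have int: "integrable M (\<lambda>\<omega>. D s \<omega> * D t \<omega>)" for s t
    by (rule integrable_const_bound[where B = "c * c"])
       (use ae in \<open>auto simp: abs_mult elim!: eventually_mono intro!: mult_mono order.trans[OF abs_ge_zero]\<close>)
  have orth': "expectation (\<lambda>\<omega>. D s \<omega> * D t \<omega>) = 0" if "s \<noteq> t" for s t
    using that orth[of s t] orth[of t s] by (cases "s < t") (auto simp: mult.commute)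
  have dd: "expectation (\<lambda>\<omega>. D t \<omega> * D t \<omega>) \<le> c\<^sup>2" for t
  proof -
    have "AE \<omega> in M. D t \<omega> * D t \<omega> \<le> c\<^sup>2"
      using ae
    proof eventually_elim
      case (elim \<omega>)
      have "\<bar>D t \<omega>\<bar>\<^sup>2 \<le> c\<^sup>2" by (rule power_mono) (use elim in auto)
      thus ?case by (simp add: power2_eq_square)
    qed
    hence "expectation (\<lambda>\<omega>. D t \<omega> * D t \<omega>) \<le> expectation (\<lambda>\<omega>. c\<^sup>2)"
      by (intro integral_mono_AE int) auto
    thus ?thesis by (simp add: prob_space)
  qed
  have sqeq: "(S N \<omega>)\<^sup>2 = (\<Sum>s<N. \<Sum>t<N. D s \<omega> * D t \<omega>)" for N \<omega>
    by (simp add: S_def power2_eq_square sum_product)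
  have intS: "integrable M (\<lambda>\<omega>. (S N \<omega>)\<^sup>2)" for N
    unfolding sqeq by (intro Bochner_Integration.integrable_sum int)
  have ES: "expectation (\<lambda>\<omega>. (S N \<omega>)\<^sup>2) \<le> c\<^sup>2 * real N" for N
  proof -
    have "expectation (\<lambda>\<omega>. (S N \<omega>)\<^sup>2) = (\<Sum>s<N. \<Sum>t<N. expectation (\<lambda>\<omega>. D s \<omega> * D t \<omega>))"
      unfolding sqeq by (simp add: Bochner_Integration.integral_sum int)
    also have "\<dots> = (\<Sum>s<N. \<Sum>t<N. if s = t then expectation (\<lambda>\<omega>. D s \<omega> * D s \<omega>) else 0)"
      by (intro sum.cong refl) (auto simp: orth')
    also have "\<dots> = (\<Sum>s<N. expectation (\<lambda>\<omega>. D s \<omega> * D s \<omega>))" by simp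
    also have "\<dots> \<le> (\<Sum>s<N. c\<^sup>2)" by (intro sum_mono dd)
    finally show ?thesis by (simp add: mult.commute)
  qed
  define Y where "Y k \<omega> = (S ((Suc k)\<^sup>2) \<omega> / real ((Suc k)\<^sup>2))\<^sup>2" for k \<omega>
  have [measurable]: "Y k \<in> borel_measurable M" for k unfolding Y_def by measurable
  have EY: "(\<integral>\<^sup>+\<omega>. ennreal (Y k \<omega>) \<partial>M) \<le> ennreal (c\<^sup>2 * (1 / (real (Suc k))\<^sup>2))" for k
  proof -
    have i: "integrable M (Y k)" unfolding Y_def power_divide by (intro integrable_divide intS)
    have "(\<integral>\<^sup>+\<omega>. ennreal (Y k \<omega>) \<partial>M) = ennreal (expectation (Y k))"
      by (rule nn_integral_eq_integral[OF i]) (simp add: Y_def)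
    also have "expectation (Y k) = expectation (\<lambda>\<omega>. (S ((Suc k)\<^sup>2) \<omega>)\<^sup>2) / (real ((Suc k)\<^sup>2))\<^sup>2"
      unfolding Y_def power_divide by simp
    also have "\<dots> \<le> c\<^sup>2 * real ((Suc k)\<^sup>2) / (real ((Suc k)\<^sup>2))\<^sup>2"
      by (intro divide_right_mono ES) simp
    also have "\<dots> = c\<^sup>2 * (1 / (real (Suc k))\<^sup>2)"
      by (simp add: power2_eq_square[of "real (Suc k)"] power2_eq_square[of "real ((Suc k)\<^sup>2)"] field_simps)
    finally show ?thesis by (simp add: ennreal_leI)
  qed
  have sm: "summable (\<lambda>k. c\<^sup>2 * (1 / (real (Suc k))\<^sup>2))"
    using inverse_squares_sums by (intro summable_mult) (simp add: sums_iff add.commute)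
  have "(\<integral>\<^sup>+\<omega>. (\<Sum>k. ennreal (Y k \<omega>)) \<partial>M) = (\<Sum>k. \<integral>\<^sup>+\<omega>. ennreal (Y k \<omega>) \<partial>M)"
    by (rule nn_integral_suminf) measurable
  also have "\<dots> \<le> (\<Sum>k. ennreal (c\<^sup>2 * (1 / (real (Suc k))\<^sup>2)))"
    by (intro suminf_le EY) auto
  also have "\<dots> = ennreal (\<Sum>k. c\<^sup>2 * (1 / (real (Suc k))\<^sup>2))"
    by (rule suminf_ennreal2[OF _ sm]) simp
  also have "\<dots> < \<infinity>" by simp
  finally have "(\<integral>\<^sup>+\<omega>. (\<Sum>k. ennreal (Y k \<omega>)) \<partial>M) \<noteq> \<infinity>" by simp
  hence "AE \<omega> in M. (\<Sum>k. ennreal (Y k \<omega>)) \<noteq> \<infinity>"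
    by (intro nn_integral_noteq_infinite) measurable
  with ae show ?thesis
  proof eventually_elim
    case (elim \<omega>)
    have "summable (\<lambda>k. Y k \<omega>)"
      by (rule summable_suminf_not_top) (use elim in \<open>auto simp: Y_def\<close>)
    hence "(\<lambda>k. Y k \<omega>) \<longlonglongrightarrow> 0" by (rule summable_LIMSEQ_zero)
    hence "(\<lambda>k. sqrt (Y k \<omega>)) \<longlonglongrightarrow> sqrt 0" by (rule tendsto_real_sqrt)
    hence "(\<lambda>k. \<bar>S ((Suc k)\<^sup>2) \<omega> / real ((Suc k)\<^sup>2)\<bar>) \<longlonglongrightarrow> 0"
      by (simp only: Y_def real_sqrt_abs real_sqrt_zero)
    hence "(\<lambda>k. S ((Suc k)\<^sup>2) \<omega> / real ((Suc k)\<^sup>2)) \<longlonglongrightarrow> 0" by (rule tendsto_rabs_zero_cancel)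
    thus ?case using elim unfolding S_def by (intro average_tendsto_0_from_squares[of _ c]) auto
  qed
qed

lemma infinite_if_average_pos:
  fixes p :: real
  assumes lim: "(\<lambda>N. (\<Sum>t<N. of_bool (P t)) / real N) \<longlonglongrightarrow> p" and p: "p > 0"
  shows "infinite {t. P t}"
proof
  assume fin: "finite {t. P t}"
  have "(\<lambda>N. (\<Sum>t<N. of_bool (P t) :: real) / real N) \<longlonglongrightarrow> 0"
  proof (rule Lim_null_comparison)
    have "\<bar>\<Sum>t<N. of_bool (P t) :: real\<bar> \<le> real (card {t. P t})" for N
    proof -
      have "(\<Sum>t<N. of_bool (P t) :: real) = real (card ({..<N} \<inter> {t. P t}))"
        by simp
      also have "\<dots> \<le> real (card {t. P t})" using fin by (intro of_nat_mono card_mono) auto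
      finally show ?thesis by (simp add: sum_nonneg)
    qed
    thus "\<forall>\<^sub>F N in sequentially. norm ((\<Sum>t<N. of_bool (P t) :: real) / real N) \<le> real (card {t. P t}) / real N"
      by (intro always_eventually) (auto simp: divide_right_mono)
    show "(\<lambda>N. real (card {t. P t}) / real N) \<longlonglongrightarrow> 0" by (rule lim_const_over_n)
  qed
  with lim p show False using LIMSEQ_unique by fastforce
qed

section \<open>Cycles of a sample path\<close>

text \<open>A clock for the cycles that is recursive in time: its value at \<open>t\<close> depends
  only on \<open>f 0\<close>, ..., \<open>f t\<close>, whereas \<open>occupied_at\<close> looks
  ahead. Events about it therefore belong to the past at time \<open>t\<close>.\<close>

primrec cycle_index :: "(nat \<Rightarrow> real) \<Rightarrow> nat \<Rightarrow> nat" where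
  "cycle_index f 0 = 0"
| "cycle_index f (Suc t) = cycle_index f t + of_bool (f t = 0 \<and> f (Suc t) > 0)"

lemma next_time:
  assumes "infinite {t. P t}"
  shows "s < next_time P s" "P (next_time P s)"
    "\<And>t. s < t \<Longrightarrow> t < next_time P s \<Longrightarrow> \<not> P t"
proof -
  have "\<exists>t. s < t \<and> P t" using assms by (auto simp: infinite_nat_iff_unbounded)
  from LeastI_ex[OF this] show "s < next_time P s" "P (next_time P s)" by (auto simp: next_time_def)
  show "\<And>t. s < t \<Longrightarrow> t < next_time P s \<Longrightarrow> \<not> P t"
    unfolding next_time_def using not_less_Least by blast
qed

context
  fixes f :: "nat \<Rightarrow> real"
  assumes nonneg: "\<And>t. 0 \<le> f t" and start: "f 0 > 0"
    and zeros: "infinite {t. f t = 0}" and positives: "infinite {t. f t > 0}"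
begin

lemma occupied_at_less_emptied_at: "occupied_at f i < emptied_at f i"
  unfolding emptied_at_def by (rule next_time(1)[OF zeros])

lemma emptied_at_less_occupied_at: "emptied_at f i < occupied_at f (Suc i)"
  unfolding emptied_at_def occupied_at.simps by (rule next_time(1)[OF positives])

lemma pos_between:
  assumes "occupied_at f i \<le> t" "t < emptied_at f i" shows "f t > 0"
proof (cases "t = occupied_at f i")
  case True thus ?thesis using start next_time(2)[OF positives] by (cases i) auto
next
  case False
  hence "f t \<noteq> 0" using assms next_time(3)[OF zeros, of "occupied_at f i" t] by (auto simp: emptied_at_def)
  thus ?thesis using nonneg[of t] by simp
qed

lemma zero_between:
  assumes "emptied_at f i \<le> t" "t < occupied_at f (Suc i)" shows "f t = 0"
proof (cases "t = emptied_at f i")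
  case True thus ?thesis using next_time(2)[OF zeros] by (auto simp: emptied_at_def)
next
  case False
  hence "\<not> f t > 0" using assms next_time(3)[OF positives, of "emptied_at f i" t] by (auto simp: emptied_at_def)
  thus ?thesis using nonneg[of t] by simp
qed

text \<open>The first premise is what \<open>cycle_index_occupied_at\<close> proves for every
  \<open>i\<close>; as a premise it lets that induction use this lemma for the preceding
  cycle.\<close>

lemma cycle_index_emptied_at:
  assumes "cycle_index f (occupied_at f i) = i" "occupied_at f i \<le> t" "t < occupied_at f (Suc i)"
  shows "cycle_index f t = i"
  using assms(2,3)
proof (induction t rule: dec_induct)
  case base show ?case by (rule assms(1))
next
  case (step t)
  have "\<not> (f t = 0 \<and> f (Suc t) > 0)"
  proof (cases "t < emptied_at f i")
    case True thus ?thesis using pos_between[of i t] step by auto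
  next
    case False thus ?thesis using zero_between[of i "Suc t"] step by auto
  qed
  thus ?case using step by simp
qed

lemma cycle_index_occupied_at: "cycle_index f (occupied_at f i) = i"
proof (induction i)
  case (Suc i)
  \<comment> \<open>The last instant before cycle \<open>Suc i\<close>: the memory is empty there,
    and the counter moves in the very next step.\<close>
  define o' where "o' = occupied_at f (Suc i) - 1"
  have o: "occupied_at f (Suc i) = Suc o'" "emptied_at f i \<le> o'"
    using emptied_at_less_occupied_at[of i] by (auto simp: o'_def)
  have "f o' = 0" using o by (intro zero_between[of i]) linarith+
  moreover have "f (Suc o') > 0" using pos_between[of "Suc i" "Suc o'"] occupied_at_less_emptied_at[of "Suc i"] o(1) by linarith
  moreover have "cycle_index f o' = i"
    using o occupied_at_less_emptied_at[of i] by (intro cycle_index_emptied_at[OF Suc]) linarith+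
  ultimately show ?case unfolding o(1) by simp
qed simp

lemma in_some_cycle: "\<exists>j. occupied_at f j \<le> t \<and> t < occupied_at f (Suc j)"
proof (induction t)
  case 0
  have "0 < occupied_at f (Suc 0)" using emptied_at_less_occupied_at[of 0] by linarith
  thus ?case by (intro exI[of _ 0]) simp
next
  case (Suc t)
  then obtain j where j: "occupied_at f j \<le> t" "t < occupied_at f (Suc j)" by blast
  show ?case
  proof (cases "Suc t < occupied_at f (Suc j)")
    case True thus ?thesis using j by (intro exI[of _ j]) linarith
  next
    case False thus ?thesis
      using j occupied_at_less_emptied_at[of "Suc j"] emptied_at_less_occupied_at[of "Suc j"]
      by (intro exI[of _ "Suc j"]) linarith
  qed
qed

lemma cycle_index_eq_iff: "cycle_index f t = i \<longleftrightarrow> occupied_at f i \<le> t \<and> t < occupied_at f (Suc i)"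
  using in_some_cycle[of t] cycle_index_emptied_at[OF cycle_index_occupied_at] by blast

text \<open>A duration is the number of its instants. Written as a series of indicators at fixed
  times, it can be integrated term by term.\<close>

lemma occupied_sums:
  "(\<lambda>t. of_bool (f t > 0 \<and> cycle_index f t = i)) sums real (emptied_at f i - occupied_at f i)"
proof -
  have "f t > 0 \<and> cycle_index f t = i \<longleftrightarrow> t \<in> {occupied_at f i..<emptied_at f i}" for t
    unfolding cycle_index_eq_iff
    using pos_between[of i t] zero_between[of i t] emptied_at_less_occupied_at[of i]
    by (cases "t < emptied_at f i") (auto simp del: occupied_at.simps)
  hence "(\<lambda>t. of_bool (f t > 0 \<and> cycle_index f t = i) :: real) =
     (\<lambda>t. if t \<in> {occupied_at f i..<emptied_at f i} then 1 else 0)" by (simp add: of_bool_def)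
  thus ?thesis using sums_If_finite_set[of "{occupied_at f i..<emptied_at f i}" "\<lambda>_. 1::real"] by simp
qed

lemma empty_sums:
  "(\<lambda>t. of_bool (f t = 0 \<and> cycle_index f t = i)) sums real (occupied_at f (Suc i) - emptied_at f i)"
proof -
  have "f t = 0 \<and> cycle_index f t = i \<longleftrightarrow> t \<in> {emptied_at f i..<occupied_at f (Suc i)}" for t
    unfolding cycle_index_eq_iff
    using pos_between[of i t] zero_between[of i t] occupied_at_less_emptied_at[of i]
    by (cases "t < emptied_at f i") (auto simp del: occupied_at.simps)
  hence "(\<lambda>t. of_bool (f t = 0 \<and> cycle_index f t = i) :: real) =
     (\<lambda>t. if t \<in> {emptied_at f i..<occupied_at f (Suc i)} then 1 else 0)" by (simp add: of_bool_def)
  thus ?thesis using sums_If_finite_set[of "{emptied_at f i..<occupied_at f (Suc i)}" "\<lambda>_. 1::real"] by simp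
qed

end

section \<open>Sub-sigma-algebras generated by independent variables\<close>

text \<open>Pulled back from the product space, the form in which \<open>indep_var_restrict\<close>
  delivers the independence of disjoint blocks.\<close>

definition generated :: "'a measure \<Rightarrow> ('i \<Rightarrow> 'a \<Rightarrow> real) \<Rightarrow> 'i set \<Rightarrow> 'a measure" where
  "generated M V A = vimage_algebra (space M) (\<lambda>\<omega>. \<lambda>i\<in>A. V i \<omega>) (Pi\<^sub>M A (\<lambda>_. borel))"

lemma space_generated [simp]: "space (generated M V A) = space M"
  by (simp add: generated_def)

lemma measurable_generated:
  assumes "i \<in> A" shows "V i \<in> borel_measurable (generated M V A)"
proof -
  have "(\<lambda>\<omega>. \<lambda>i\<in>A. V i \<omega>) \<in> measurable (generated M V A) (Pi\<^sub>M A (\<lambda>_. borel))"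
    unfolding generated_def by (rule measurable_vimage_algebra1) (auto simp: space_PiM)
  from measurable_compose[OF this measurable_component_singleton[OF assms]] assms
  show ?thesis by simp
qed

lemma sets_generated_subset:
  assumes "space N = space M" "\<And>i. i \<in> A \<Longrightarrow> V i \<in> borel_measurable N"
  shows "sets (generated M V A) \<subseteq> sets N"
  unfolding generated_def
  by (rule sets_image_in_sets) (use assms in \<open>auto intro!: measurable_restrict\<close>)

lemma measurable_from_generated:
  assumes "f \<in> measurable (generated M V A) S" "space N = space M"
    "\<And>i. i \<in> A \<Longrightarrow> V i \<in> borel_measurable N"
  shows "f \<in> measurable N S"
proof (rule measurableI)
  show "f x \<in> space S" if "x \<in> space N" for x
    using measurable_space[OF assms(1)] that assms(2) by simp
  show "f -` X \<inter> space N \<in> sets N" if "X \<in> sets S" for X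
    using measurable_sets[OF assms(1) that] sets_generated_subset[of N M A V] assms(2,3) by auto
qed

lemma measurable_generated_mono:
  assumes "f \<in> measurable (generated M V A) S" "A \<subseteq> B"
  shows "f \<in> measurable (generated M V B) S"
  by (rule measurable_from_generated[OF assms(1)]) (use assms(2) in \<open>auto intro: measurable_generated\<close>)

context prob_space
begin

text \<open>Preimages under \<open>f\<close> and \<open>g\<close> lie in two independent
  sigma-algebras, so neither has to be exhibited as a function of the variables in its
  block.\<close>

lemma indep_var_generated:
  assumes ind: "indep_vars (\<lambda>_. borel) V I" and AB: "A \<inter> B = {}" "A \<subseteq> I" "B \<subseteq> I"
    and f: "f \<in> measurable (generated M V A) S" and g: "g \<in> measurable (generated M V B) T"
  shows "indep_var S f T g"
proof -
  have V: "V i \<in> borel_measurable M" if "i \<in> I" for i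
    using ind that by (auto simp: indep_vars_def)
  have fm: "f \<in> measurable M S" by (rule measurable_from_generated[OF f]) (use AB V in auto)
  have gm: "g \<in> measurable M T" by (rule measurable_from_generated[OF g]) (use AB V in auto)
  have "indep_set (sets (generated M V A)) (sets (generated M V B))"
    using indep_var_restrict[OF ind AB]
    by (simp add: indep_var_eq generated_def sets_vimage_algebra)
  hence prod: "prob (a \<inter> b) = prob a * prob b"
    if "a \<in> sets (generated M V A)" "b \<in> sets (generated M V B)" for a b
    using that by (auto simp: indep_sets2_eq)
  have sf: "sigma_sets (space M) {f -` X \<inter> space M | X. X \<in> sets S} \<subseteq> sets (generated M V A)"
    using measurable_sets[OF f] by (subst space_generated[of M V A, symmetric], intro sets.sigma_sets_subset) auto
  have sg: "sigma_sets (space M) {g -` X \<inter> space M | X. X \<in> sets T} \<subseteq> sets (generated M V B)"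
    using measurable_sets[OF g] by (subst space_generated[of M V B, symmetric], intro sets.sigma_sets_subset) auto
  have "sigma_sets (space M) {f -` X \<inter> space M | X. X \<in> sets S} \<subseteq> events"
    using measurable_sets[OF fm] by (intro sets.sigma_sets_subset) auto
  moreover have "sigma_sets (space M) {g -` X \<inter> space M | X. X \<in> sets T} \<subseteq> events"
    using measurable_sets[OF gm] by (intro sets.sigma_sets_subset) auto
  ultimately show ?thesis
    unfolding indep_var_eq indep_sets2_eq using fm gm prod sf sg by blast
qed

text \<open>By independence and Fubini, \<open>U\<close> may be integrated out with \<open>H\<close>
  and \<open>P\<close> frozen; a uniform variable lies below \<open>p\<close> with probability
  \<open>p\<close> when 0 <= \<open>p\<close> <= 1.\<close>

lemma expectation_indep_uniform_less:
  fixes H P U :: "'a \<Rightarrow> real"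
  assumes "indep_vars (\<lambda>_. borel) V I" "A \<inter> B = {}" "A \<subseteq> I" "B \<subseteq> I"
    and HPU: "H \<in> borel_measurable (generated M V A)" "P \<in> borel_measurable (generated M V A)"
      "U \<in> borel_measurable (generated M V B)"
    and U: "distr M borel U = uniform_measure lborel {0..1}"
    and H: "AE \<omega> in M. \<bar>H \<omega>\<bar> \<le> c" and P: "AE \<omega> in M. 0 \<le> P \<omega> \<and> P \<omega> \<le> 1"
  shows "expectation (\<lambda>\<omega>. H \<omega> * of_bool (U \<omega> < P \<omega>)) = expectation (\<lambda>\<omega>. H \<omega> * P \<omega>)"
proof -
  \<comment> \<open>\<open>indep_var\<close> wants both variables in the same type, so \<open>U\<close> is padded to a pair.\<close>
  have ind: "indep_var (borel \<Otimes>\<^sub>M borel) (\<lambda>\<omega>. (H \<omega>, P \<omega>)) (borel \<Otimes>\<^sub>M borel) (\<lambda>\<omega>. (U \<omega>, 0 :: real))"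
    by (rule indep_var_generated[OF assms(1-4)]) (intro measurable_Pair HPU measurable_const; simp)+
  have Z [measurable]: "(\<lambda>\<omega>. (H \<omega>, P \<omega>)) \<in> measurable M (borel \<Otimes>\<^sub>M borel)"
    and Um': "(\<lambda>\<omega>. (U \<omega>, 0 :: real)) \<in> measurable M (borel \<Otimes>\<^sub>M borel)"
    using ind by (auto simp: indep_var_distribution_eq)
  have Um [measurable]: "U \<in> borel_measurable M" using measurable_compose[OF Um' measurable_fst] by simp
  have Hm [measurable]: "H \<in> borel_measurable M" using measurable_compose[OF Z measurable_fst] by simp
  have Pm [measurable]: "P \<in> borel_measurable M" using measurable_compose[OF Z measurable_snd] by simp
  define Zd where "Zd = distr M (borel \<Otimes>\<^sub>M borel) (\<lambda>\<omega>. (H \<omega>, P \<omega>))"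
  define Ud where "Ud = distr M (borel \<Otimes>\<^sub>M borel) (\<lambda>\<omega>. (U \<omega>, 0 :: real))"
  interpret Z: prob_space Zd unfolding Zd_def by (rule prob_space_distr) measurable
  interpret U: prob_space Ud unfolding Ud_def by (rule prob_space_distr) measurable
  interpret ZU: pair_prob_space Zd Ud ..
  have sZ [measurable_cong]: "sets Zd = sets (borel \<Otimes>\<^sub>M borel)" by (simp add: Zd_def)
  have sU [measurable_cong]: "sets Ud = sets (borel \<Otimes>\<^sub>M borel)" by (simp add: Ud_def)
  define \<phi> :: "(real \<times> real) \<times> real \<times> real \<Rightarrow> real" where "\<phi> = (\<lambda>((h, p), u, _). h * of_bool (u < p))"
  have \<phi>m [measurable]: "\<phi> \<in> borel_measurable ((borel \<Otimes>\<^sub>M borel) \<Otimes>\<^sub>M (borel \<Otimes>\<^sub>M borel))"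
    unfolding \<phi>_def of_bool_def split_beta by measurable
  have pair: "Zd \<Otimes>\<^sub>M Ud = distr M ((borel \<Otimes>\<^sub>M borel) \<Otimes>\<^sub>M (borel \<Otimes>\<^sub>M borel)) (\<lambda>\<omega>. ((H \<omega>, P \<omega>), U \<omega>, 0))"
    using ind unfolding Zd_def Ud_def by (simp add: indep_var_distribution_eq)
  have int: "integrable (Zd \<Otimes>\<^sub>M Ud) \<phi>"
    unfolding pair
  proof (subst integrable_distr_eq)
    show "integrable M (\<lambda>\<omega>. \<phi> ((H \<omega>, P \<omega>), U \<omega>, 0))"
      by (rule integrable_const_bound[where B = "\<bar>c\<bar>"])
         (use H in \<open>auto simp: \<phi>_def elim!: eventually_mono\<close>)
  qed measurable
  \<comment> \<open>A frozen \<open>p\<close> is an arbitrary real, so its probability is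
    \<open>p\<close> clamped to [0, 1]. The clamp disappears at the end, because \<open>P\<close>
    lies in [0, 1] almost surely.\<close>
  have inner: "(\<integral>u. \<phi> ((h, p), u) \<partial>Ud) = h * max 0 (min 1 p)" for h p
  proof -
    have "(\<integral>u. \<phi> ((h, p), u) \<partial>Ud) = expectation (\<lambda>\<omega>. \<phi> ((h, p), U \<omega>, 0))"
      unfolding Ud_def by (rule integral_distr) measurable
    also have "\<dots> = (\<integral>u. h * indicator {..<p} u \<partial>distr M borel U)"
      by (subst integral_distr) (auto simp: \<phi>_def indicator_def of_bool_def)
    also have "\<dots> = h * measure (distr M borel U) {..<p}"
      by simp
    also have "measure (distr M borel U) {..<p} = measure lborel ({0..1} \<inter> {..<p})"
      unfolding U by (subst measure_uniform_measure) (simp_all add: emeasure_lborel_Icc)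
    also have "{0..1} \<inter> {..<p} = (if p > 1 then {0..1} else {0..<p})" by auto
    also have "measure lborel \<dots> = max 0 (min 1 p)" by (simp add: max_def min_def)
    finally show ?thesis .
  qed
  have "expectation (\<lambda>\<omega>. H \<omega> * of_bool (U \<omega> < P \<omega>)) = integral\<^sup>L (Zd \<Otimes>\<^sub>M Ud) \<phi>"
    unfolding pair by (subst integral_distr[OF _ \<phi>m]) (measurable, simp_all add: \<phi>_def)
  also have "\<dots> = (\<integral>z. (\<integral>u. \<phi> (z, u) \<partial>Ud) \<partial>Zd)"
    by (rule ZU.integral_fst'[OF int, symmetric])
  also have "\<dots> = (\<integral>z. fst z * max 0 (min 1 (snd z)) \<partial>Zd)"
  proof (intro Bochner_Integration.integral_cong refl)
    fix z show "(\<integral>u. \<phi> (z, u) \<partial>Ud) = fst z * max 0 (min 1 (snd z))"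
      using inner[of "fst z" "snd z"] by simp
  qed
  also have "\<dots> = expectation (\<lambda>\<omega>. H \<omega> * max 0 (min 1 (P \<omega>)))"
    unfolding Zd_def by (subst integral_distr[OF Z]) simp_all
  also have "\<dots> = expectation (\<lambda>\<omega>. H \<omega> * P \<omega>)"
  proof (rule integral_cong_AE)
    show "AE \<omega> in M. H \<omega> * max 0 (min 1 (P \<omega>)) = H \<omega> * P \<omega>"
      using P by eventually_elim simp
  qed simp_all
  finally show ?thesis .
qed

end

section \<open>The driving variables\<close>

lemma borel_measurable_memory_step:
  assumes [measurable]: "r \<in> measurable N (count_space UNIV)" "k \<in> measurable N (count_space UNIV)"
    "u \<in> measurable N (count_space UNIV)" "w \<in> borel_measurable N" "x \<in> borel_measurable N"
  shows "(\<lambda>\<omega>. memory_step a b c d \<Gamma> F_new (r \<omega>) (k \<omega>) (u \<omega>) (w \<omega>) (x \<omega>)) \<in> borel_measurable N"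
proof -
  have [measurable]: "(\<lambda>\<omega>. v (k \<omega>)) \<in> borel_measurable N" for v :: "nat \<Rightarrow> real"
    by (rule measurable_compose[OF assms(2)]) simp
  show ?thesis unfolding memory_step_def success_prob_def jump_def decohere_def by measurable
qed

context link_1GnB
begin

definition driver :: "source \<times> nat \<Rightarrow> 'a \<Rightarrow> real" where
  "driver = (\<lambda>(s, t) \<omega>. case s of
           Request \<Rightarrow> of_bool (X t \<omega>)
         | Generation \<Rightarrow> real (K t \<omega>)
         | Decision \<Rightarrow> of_bool (Q t \<omega>)
         | Purification \<Rightarrow> W t \<omega>)"

lemma indep_driver: "indep_vars (\<lambda>_. borel) driver (UNIV \<times> {1..})"
  using indep by (simp add: driver_def)

abbreviation field_of :: "(source \<times> nat) set \<Rightarrow> 'a measure" where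
  "field_of \<equiv> generated M driver"

text \<open>No driver has time index 0, so \<open>past 0\<close> is empty; this fits
  \<open>F 0\<close>, which is constant.\<close>

abbreviation past :: "nat \<Rightarrow> (source \<times> nat) set" where
  "past t \<equiv> UNIV \<times> {1..t}"

text \<open>The discrete variables are recovered from their real encodings in \<open>driver\<close>:
  truth values by comparison with 0, the number of links by rounding down.\<close>

lemma measurable_X_field: "(Request, t) \<in> A \<Longrightarrow> X t \<in> measurable (field_of A) (count_space UNIV)"
proof -
  assume "(Request, t) \<in> A"
  note [measurable] = measurable_generated[OF this, of driver M]
  have "Measurable.pred (field_of A) (\<lambda>\<omega>. driver (Request, t) \<omega> > 0)" by measurable
  thus ?thesis by (simp add: driver_def)
qed

lemma measurable_Q_field: "(Decision, t) \<in> A \<Longrightarrow> Q t \<in> measurable (field_of A) (count_space UNIV)"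
proof -
  assume "(Decision, t) \<in> A"
  note [measurable] = measurable_generated[OF this, of driver M]
  have "Measurable.pred (field_of A) (\<lambda>\<omega>. driver (Decision, t) \<omega> > 0)" by measurable
  thus ?thesis by (simp add: driver_def)
qed

lemma measurable_K_field: "(Generation, t) \<in> A \<Longrightarrow> K t \<in> measurable (field_of A) (count_space UNIV)"
proof -
  assume "(Generation, t) \<in> A"
  note [measurable] = measurable_generated[OF this, of driver M]
  have "(\<lambda>\<omega>. nat \<lfloor>driver (Generation, t) \<omega>\<rfloor>) \<in> measurable (field_of A) (count_space UNIV)" by measurable
  thus ?thesis by (simp add: driver_def)
qed

lemma measurable_W_field: "(Purification, t) \<in> A \<Longrightarrow> W t \<in> borel_measurable (field_of A)"
  using measurable_generated[of "(Purification, t)" A driver M] by (simp add: driver_def)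

lemma measurable_F_field: "F t \<in> borel_measurable (field_of (past t))"
proof (induction t)
  case 0
  have "F 0 \<in> borel_measurable (field_of (past 0)) \<longleftrightarrow> (\<lambda>_. F_new) \<in> borel_measurable (field_of (past 0))"
    by (rule measurable_cong) (simp add: F_0)
  thus ?case by simp
next
  case (Suc t)
  have "F t \<in> borel_measurable (field_of (past (Suc t)))"
    by (rule measurable_generated_mono[OF Suc]) auto
  hence "(\<lambda>\<omega>. memory_step a b c d \<Gamma> F_new (X (Suc t) \<omega>) (K (Suc t) \<omega>) (Q (Suc t) \<omega>) (W (Suc t) \<omega>) (F t \<omega>))
      \<in> borel_measurable (field_of (past (Suc t)))"
    by (intro borel_measurable_memory_step measurable_X_field measurable_K_field measurable_Q_field
        measurable_W_field) auto
  also have "?this \<longleftrightarrow> ?case"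
    by (rule measurable_cong) (simp add: F_step[of _ "Suc t"])
  finally show ?case .
qed

definition cycle :: "nat \<Rightarrow> 'a \<Rightarrow> nat" where
  "cycle t \<omega> = cycle_index (\<lambda>t. F t \<omega>) t"

lemma measurable_cycle_field: "cycle t \<in> measurable (field_of (past t)) (count_space UNIV)"
proof (induction t)
  case 0
  show ?case by (simp add: cycle_def)
next
  case (Suc t)
  have [measurable]: "cycle t \<in> measurable (field_of (past (Suc t))) (count_space UNIV)"
    by (rule measurable_generated_mono[OF Suc]) auto
  have [measurable]: "F t \<in> borel_measurable (field_of (past (Suc t)))"
    by (rule measurable_generated_mono[OF measurable_F_field]) auto
  note [measurable] = measurable_F_field[of "Suc t"]
  have "(\<lambda>\<omega>. cycle t \<omega> + (if F t \<omega> = 0 \<and> F (Suc t) \<omega> > 0 then 1 else 0)) \<in> measurable (field_of (past (Suc t))) (count_space UNIV)"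
    by measurable
  thus ?case by (simp add: cycle_def of_bool_def cong: measurable_cong)
qed

lemma measurable_from_field:
  assumes "f \<in> measurable (field_of A) N" "A \<subseteq> UNIV \<times> {1..}"
  shows "f \<in> measurable M N"
proof (rule measurable_from_generated[OF assms(1) refl])
  fix i assume "i \<in> A"
  thus "driver i \<in> borel_measurable M" using assms(2) indep_driver unfolding indep_vars_def by blast
qed

lemma F_measurable [measurable]: "F t \<in> borel_measurable M"
  by (rule measurable_from_field[OF measurable_F_field]) auto

lemma cycle_measurable [measurable]: "cycle t \<in> measurable M (count_space UNIV)"
  by (rule measurable_from_field[OF measurable_cycle_field]) auto

section \<open>Path properties that hold almost surely\<close>

lemma AE_drivers: "AE \<omega> in M. \<forall>t\<ge>1. K t \<omega> \<le> n \<and> 0 \<le> W t \<omega>"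
proof -
  have "AE \<omega> in M. t \<ge> 1 \<longrightarrow> K t \<omega> \<le> n \<and> 0 \<le> W t \<omega>" for t
  proof (cases "t \<ge> 1")
    case True
    note [measurable] = K_measurable[OF True] W_measurable[OF True]
    have "AE k in measure_pmf (binomial_pmf n p_gen). k \<le> n"
      using set_pmf_binomial_eq[of p_gen n] p_gen by (auto simp: AE_measure_pmf_iff split: if_splits)
    hence "AE \<omega> in M. K t \<omega> \<le> n"
      unfolding K_law[OF True, symmetric] by (subst (asm) AE_distr_iff) auto
    moreover have "AE w in uniform_measure lborel {0..1::real}. 0 \<le> w"
      by (rule AE_uniform_measureI) auto
    hence "AE \<omega> in M. 0 \<le> W t \<omega>"
      unfolding W_law[OF True, symmetric] by (subst (asm) AE_distr_iff) auto
    ultimately show ?thesis by eventually_elim simp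
  qed simp
  thus ?thesis by (simp add: AE_all_countable)
qed

lemma decohere_range:
  assumes "x \<in> {1/4..1}" shows "decohere \<Gamma> x \<in> {1/4..1}"
proof -
  have "0 \<le> exp (-\<Gamma>) * (x - 1/4)" "exp (-\<Gamma>) * (x - 1/4) \<le> 1 * (x - 1/4)"
    using assms \<Gamma> by (simp, intro mult_right_mono) auto
  thus ?thesis using assms by (auto simp: decohere_def)
qed

lemma jump_range:
  assumes "k \<in> {1..n}" "x \<in> {1/4..1}" "success_prob c d k x > 0"
  shows "jump a b c d k x \<in> {1/4..1}"
  using physical_jump[OF assms(1,2)] assms(3)
  by (auto simp: jump_def success_prob_def divide_simps)

text \<open>Excludes the null set on which the policy is unconstrained. The bound
  \<open>0 \<le> W t \<omega>\<close> matters as well: a success \<open>W < p\<close> then forces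
  \<open>p > 0\<close>, so the jump that is taken is never a division by 0.\<close>

definition regular :: "'a \<Rightarrow> bool" where
  "regular \<omega> \<longleftrightarrow> \<omega> \<in> space M \<and> (\<forall>t\<ge>1. K t \<omega> \<le> n \<and> 0 \<le> W t \<omega>)"

lemma AE_regular: "AE \<omega> in M. regular \<omega>"
  using AE_drivers AE_space by eventually_elim (simp add: regular_def)

lemma F_range: "regular \<omega> \<Longrightarrow> F t \<omega> = 0 \<or> F t \<omega> \<in> {1/4..1}"
proof (induction t)
  case 0 thus ?case using F_new F_0 by (auto simp: regular_def)
next
  case (Suc t)
  have KW: "K (Suc t) \<omega> \<le> n" "0 \<le> W (Suc t) \<omega>" using Suc.prems by (auto simp: regular_def)
  have st: "F (Suc t) \<omega> = memory_step a b c d \<Gamma> F_new (X (Suc t) \<omega>) (K (Suc t) \<omega>) (Q (Suc t) \<omega>) (W (Suc t) \<omega>) (F t \<omega>)"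
    using F_step[of \<omega> "Suc t"] Suc.prems by (simp add: regular_def)
  show ?case
  proof (cases "F t \<omega> = 0")
    case True thus ?thesis unfolding st using F_new by (auto simp: memory_step_def)
  next
    case False
    hence "F t \<omega> \<in> {1/4..1}" using Suc by auto
    from decohere_range[OF this] show ?thesis
      unfolding st memory_step_def using False KW jump_range[of "K (Suc t) \<omega>" "decohere \<Gamma> (F t \<omega>)"]
      by auto
  qed
qed

lemma F_nonneg: "regular \<omega> \<Longrightarrow> 0 \<le> F t \<omega>"
  using F_range[of \<omega> t] by auto

section \<open>Expectations of products of driving variables\<close>

lemma expectation_mult_fields:
  assumes AB: "A \<inter> B = {}" "A \<subseteq> UNIV \<times> {1..}" "B \<subseteq> UNIV \<times> {1..}"
    and H: "H \<in> borel_measurable (field_of A)" and Y: "Y \<in> borel_measurable (field_of B)"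
    and bH: "AE \<omega> in M. \<bar>H \<omega>\<bar> \<le> u" and bY: "AE \<omega> in M. \<bar>Y \<omega>\<bar> \<le> (v :: real)"
  shows "expectation (\<lambda>\<omega>. H \<omega> * Y \<omega>) = expectation H * expectation Y"
proof (rule indep_var_lebesgue_integral)
  show "indep_var borel H borel Y"
    by (rule indep_var_generated[OF indep_driver AB H Y])
  show "integrable M H"
    by (rule integrable_const_bound[where B = u]) (use bH measurable_from_field[OF H AB(2)] in auto)
  show "integrable M Y"
    by (rule integrable_const_bound[where B = v]) (use bY measurable_from_field[OF Y AB(3)] in auto)
qed

lemma expectation_X: "t \<ge> 1 \<Longrightarrow> expectation (\<lambda>\<omega>. f (X t \<omega>)) = f True * p_con + f False * (1 - p_con)"
  for f :: "bool \<Rightarrow> real"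
proof -
  assume t: "t \<ge> 1"
  have "expectation (\<lambda>\<omega>. f (X t \<omega>)) = integral\<^sup>L (distr M (count_space UNIV) (X t)) f"
    by (rule integral_distr[symmetric]) (use X_measurable[OF t] in auto)
  thus ?thesis unfolding X_law[OF t] using p_con by (simp add: mult.commute)
qed

lemma expectation_Q: "t \<ge> 1 \<Longrightarrow> expectation (\<lambda>\<omega>. f (Q t \<omega>)) = f True * q + f False * (1 - q)"
  for f :: "bool \<Rightarrow> real"
proof -
  assume t: "t \<ge> 1"
  have "expectation (\<lambda>\<omega>. f (Q t \<omega>)) = integral\<^sup>L (distr M (count_space UNIV) (Q t)) f"
    by (rule integral_distr[symmetric]) (use Q_measurable[OF t] in auto)
  thus ?thesis unfolding Q_law[OF t] using q by (simp add: mult.commute)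
qed

lemma prob_K: "t \<ge> 1 \<Longrightarrow> expectation (\<lambda>\<omega>. of_bool (K t \<omega> = k)) = real (n choose k) * p_gen ^ k * (1 - p_gen) ^ (n - k)"
proof -
  assume t: "t \<ge> 1"
  have "expectation (\<lambda>\<omega>. of_bool (K t \<omega> = k) :: real) = (\<integral>j. of_bool (j = k) \<partial>distr M (count_space UNIV) (K t))"
    by (rule integral_distr[symmetric]) (use K_measurable[OF t] in auto)
  also have "(\<lambda>j. of_bool (j = k)) = (indicator {k} :: nat \<Rightarrow> real)"
    by (auto simp: indicator_def)
  also have "integral\<^sup>L (distr M (count_space UNIV) (K t)) (indicator {k}) = pmf (binomial_pmf n p_gen) k"
    unfolding K_law[OF t] by (simp add: measure_pmf_single)
  finally show ?thesis using p_gen by (simp add: indicator_def of_bool_def)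
qed

lemma prob_K_ge_1: "t \<ge> 1 \<Longrightarrow> expectation (\<lambda>\<omega>. of_bool (K t \<omega> \<ge> 1)) = 1 - (1 - p_gen) ^ n"
proof -
  assume t: "t \<ge> 1"
  note [measurable] = K_measurable[OF t]
  have "expectation (\<lambda>\<omega>. of_bool (K t \<omega> \<ge> 1) :: real) = expectation (\<lambda>\<omega>. 1 - of_bool (K t \<omega> = 0))"
    by (intro Bochner_Integration.integral_cong) auto
  also have "\<dots> = 1 - expectation (\<lambda>\<omega>. of_bool (K t \<omega> = 0))"
  proof (subst Bochner_Integration.integral_diff)
    have "(\<lambda>\<omega>. of_bool (K t \<omega> = 0) :: real) \<in> borel_measurable M"
      unfolding of_bool_def by measurable
    thus "integrable M (\<lambda>\<omega>. of_bool (K t \<omega> = 0) :: real)"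
      by (intro integrable_const_bound[where B = 1]) auto
  qed (simp_all add: prob_space)
  finally show ?thesis using prob_K[OF t, of 0] by simp
qed

lemma expectation_XKQ:
  fixes f u :: "bool \<Rightarrow> real"
  assumes t: "t \<ge> 1"
  shows "expectation (\<lambda>\<omega>. f (X t \<omega>) * (of_bool (\<kappa> (K t \<omega>)) * u (Q t \<omega>))) =
    (f True * p_con + f False * (1 - p_con)) * (expectation (\<lambda>\<omega>. of_bool (\<kappa> (K t \<omega>))) * (u True * q + u False * (1 - q)))"
proof -
  have mX: "(\<lambda>\<omega>. f (X t \<omega>)) \<in> borel_measurable (field_of {(Request, t)})" for f :: "bool \<Rightarrow> real"
    by (rule measurable_compose[OF measurable_X_field]) auto
  have mK: "(\<lambda>\<omega>. of_bool (\<kappa> (K t \<omega>)) :: real) \<in> borel_measurable (field_of A)" if "(Generation, t) \<in> A" for A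
    by (rule measurable_compose[OF measurable_K_field[OF that]]) auto
  have mQ: "(\<lambda>\<omega>. u (Q t \<omega>)) \<in> borel_measurable (field_of A)" if "(Decision, t) \<in> A" for A
    by (rule measurable_compose[OF measurable_Q_field[OF that]]) auto
  have bf: "\<bar>f x\<bar> \<le> \<bar>f True\<bar> + \<bar>f False\<bar>" for x and f :: "bool \<Rightarrow> real" by (cases x) auto
  have "expectation (\<lambda>\<omega>. f (X t \<omega>) * (of_bool (\<kappa> (K t \<omega>)) * u (Q t \<omega>))) =
      expectation (\<lambda>\<omega>. f (X t \<omega>)) * expectation (\<lambda>\<omega>. of_bool (\<kappa> (K t \<omega>)) * u (Q t \<omega>))"
    by (rule expectation_mult_fields[where A = "{(Request, t)}" and B = "{(Generation, t), (Decision, t)}"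
          and u = "\<bar>f True\<bar> + \<bar>f False\<bar>" and v = "\<bar>u True\<bar> + \<bar>u False\<bar>"])
       (use t bf[of f] bf[of u] in \<open>auto intro!: mX mK mQ borel_measurable_times simp: abs_mult\<close>)
  also have "expectation (\<lambda>\<omega>. of_bool (\<kappa> (K t \<omega>)) * u (Q t \<omega>)) =
      expectation (\<lambda>\<omega>. of_bool (\<kappa> (K t \<omega>))) * expectation (\<lambda>\<omega>. u (Q t \<omega>))"
    by (rule expectation_mult_fields[where A = "{(Generation, t)}" and B = "{(Decision, t)}"
          and u = 1 and v = "\<bar>u True\<bar> + \<bar>u False\<bar>"])
       (use t bf[of u] in \<open>auto intro!: mK mQ\<close>)
  finally show ?thesis by (simp only: expectation_X[OF t] expectation_Q[OF t])
qed

end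

section \<open>One step of the memory\<close>

context link_1GnB
begin

definition p_none :: real where "p_none = (1 - p_gen) ^ n"
text \<open>Probability that an occupied memory merely decoheres: no request, and either a decision
  against purifying or no new link.\<close>

definition p_stay :: real where "p_stay = (1 - q + q * p_none) * (1 - p_con)"
text \<open>The event \<open>K >= 1\<close> is left out on purpose: \<open>binomial_average\<close>
  supplies the law of \<open>K\<close> restricted to it.\<close>

definition p_try :: real where "p_try = q * (1 - p_con)"

text \<open>From an occupied memory with \<open>z = F(t) - 1/4\<close>, the memory is still occupied at time \<open>t + 1\<close> with
  probability \<open>m11 + m12 z\<close>, and \<open>m21 + m22 z\<close> is the mean of \<open>F(t + 1) - 1/4\<close> on that event.\<close>

definition m11 :: real where "m11 = p_stay + p_try * binomial_average n p_gen d"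
definition m12 :: real where "m12 = exp (- \<Gamma>) * (p_try * binomial_average n p_gen c)"
definition m21 :: real where "m21 = p_try * binomial_average n p_gen b"
definition m22 :: real where "m22 = exp (- \<Gamma>) * (p_stay + p_try * binomial_average n p_gen a)"

text \<open>Functions affine in \<open>x - 1/4\<close> on an occupied memory and 0 on the empty one.
  On occupied states one step maps this two-dimensional space into itself; the empty memory
  contributes a constant.\<close>

definition obs :: "real \<Rightarrow> real \<Rightarrow> real \<Rightarrow> real" where
  "obs \<alpha> \<beta> x = (if x > 0 then \<alpha> + \<beta> * (x - 1/4) else 0)"

text \<open>Conditional mean of \<open>obs \<alpha> \<beta>\<close> one step after fidelity \<open>x\<close>.\<close>

definition next_obs :: "real \<Rightarrow> real \<Rightarrow> real \<Rightarrow> real" where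
  "next_obs \<alpha> \<beta> x =
     (if x > 0 then \<alpha> * (m11 + m12 * (x - 1/4)) + \<beta> * (m21 + m22 * (x - 1/4))
      else (1 - p_none) * (\<alpha> + \<beta> * (F_new - 1/4)))"

lemma obs_bound: "regular \<omega> \<Longrightarrow> \<bar>obs \<alpha> \<beta> (F t \<omega>)\<bar> \<le> \<bar>\<alpha>\<bar> + \<bar>\<beta>\<bar>"
proof -
  assume "regular \<omega>"
  from F_range[OF this, of t] have "F t \<omega> > 0 \<Longrightarrow> \<bar>F t \<omega> - 1/4\<bar> \<le> 1" by auto
  hence "F t \<omega> > 0 \<Longrightarrow> \<bar>\<beta> * (F t \<omega> - 1/4)\<bar> \<le> \<bar>\<beta>\<bar>" by (simp add: abs_mult mult_left_le)
  thus ?thesis by (auto simp: obs_def)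
qed

text \<open>On an occupied memory \<open>next_obs\<close> is again an \<open>obs\<close>, whose
  coefficients are the row vector (\<alpha>, \<beta>) times the step matrix.\<close>

lemma next_obs_bound:
  "regular \<omega> \<Longrightarrow> \<bar>next_obs \<alpha> \<beta> (F t \<omega>)\<bar> \<le>
     \<bar>\<alpha> * m11 + \<beta> * m21\<bar> + \<bar>\<alpha> * m12 + \<beta> * m22\<bar> + \<bar>(1 - p_none) * (\<alpha> + \<beta> * (F_new - 1/4))\<bar>"
proof -
  assume "regular \<omega>"
  from obs_bound[OF this, of "\<alpha> * m11 + \<beta> * m21" "\<alpha> * m12 + \<beta> * m22" t] show ?thesis
    by (auto simp: next_obs_def obs_def algebra_simps split: if_splits)
qed

text \<open>Each summand is a factor from the past, times a factor from the present request,
  generation and decision, times at most one uniform threshold: the shape to which independence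
  applies. The threshold carries the factor \<open>of_bool (F t \<omega> > 0)\<close> because
  \<open>success_prob\<close> need not lie in [0, 1] at fidelity 0.\<close>

lemma step_expansion:
  fixes t :: nat
  assumes reg: "regular \<omega>"
  defines "x \<equiv> decohere \<Gamma> (F t \<omega>)"
  shows "obs \<alpha> \<beta> (F (Suc t) \<omega>) =
     of_bool (F t \<omega> = 0) * obs \<alpha> \<beta> F_new * of_bool (K (Suc t) \<omega> \<ge> 1)
     + of_bool (F t \<omega> > 0) * obs \<alpha> \<beta> x * (of_bool (\<not> X (Suc t) \<omega>)
          - of_bool (\<not> X (Suc t) \<omega>) * (of_bool (K (Suc t) \<omega> \<ge> 1) * of_bool (Q (Suc t) \<omega>)))
     + (\<Sum>k = 1..n. of_bool (F t \<omega> > 0) * obs \<alpha> \<beta> (jump a b c d k x)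
          * (of_bool (\<not> X (Suc t) \<omega>) * (of_bool (K (Suc t) \<omega> = k) * of_bool (Q (Suc t) \<omega>)))
          * of_bool (W (Suc t) \<omega> < of_bool (F t \<omega> > 0) * success_prob c d k x))"
proof -
  have st: "F (Suc t) \<omega> = memory_step a b c d \<Gamma> F_new (X (Suc t) \<omega>) (K (Suc t) \<omega>) (Q (Suc t) \<omega>) (W (Suc t) \<omega>) (F t \<omega>)"
    using F_step[of \<omega> "Suc t"] reg by (simp add: regular_def)
  have Kn: "K (Suc t) \<omega> \<le> n" using reg by (auto simp: regular_def)
  have "(\<Sum>k = 1..n. of_bool (F t \<omega> > 0) * obs \<alpha> \<beta> (jump a b c d k x)
          * (of_bool (\<not> X (Suc t) \<omega>) * (of_bool (K (Suc t) \<omega> = k) * of_bool (Q (Suc t) \<omega>)))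
          * of_bool (W (Suc t) \<omega> < of_bool (F t \<omega> > 0) * success_prob c d k x))
     = (\<Sum>k = 1..n. if k = K (Suc t) \<omega> then of_bool (F t \<omega> > 0) * obs \<alpha> \<beta> (jump a b c d k x)
          * (of_bool (\<not> X (Suc t) \<omega>) * of_bool (Q (Suc t) \<omega>))
          * of_bool (W (Suc t) \<omega> < of_bool (F t \<omega> > 0) * success_prob c d k x) else 0)"
    by (intro sum.cong) auto
  also have "\<dots> = of_bool (K (Suc t) \<omega> \<ge> 1) * (of_bool (F t \<omega> > 0) * obs \<alpha> \<beta> (jump a b c d (K (Suc t) \<omega>) x)
          * (of_bool (\<not> X (Suc t) \<omega>) * of_bool (Q (Suc t) \<omega>))
          * of_bool (W (Suc t) \<omega> < of_bool (F t \<omega> > 0) * success_prob c d (K (Suc t) \<omega>) x))"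
    using Kn by (subst sum.delta) auto
  finally show ?thesis
    unfolding st memory_step_def x_def[symmetric]
    using F_nonneg[OF reg, of t] by (auto simp: obs_def)
qed

lemma obs_le: "y \<in> {1/4..1} \<Longrightarrow> \<bar>obs \<alpha> \<beta> y\<bar> \<le> \<bar>\<alpha>\<bar> + \<bar>\<beta>\<bar>"
proof -
  assume "y \<in> {1/4..1}"
  hence "\<bar>\<beta> * (y - 1/4)\<bar> \<le> \<bar>\<beta>\<bar>" by (auto simp: abs_mult intro!: mult_left_le)
  thus ?thesis by (auto simp: obs_def)
qed

text \<open>If the success probability is 0, the quotient is 0 by convention and the jump lands on
  1/4. Bounds on jumps thus hold whether or not the jump can occur.\<close>

lemma jump_range':
  assumes "k \<in> {1..n}" "x \<in> {1/4..1}" shows "jump a b c d k x \<in> {1/4..1}"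
proof (cases "success_prob c d k x > 0")
  case True thus ?thesis using jump_range assms by blast
next
  case False
  hence "success_prob c d k x = 0" using physical_prob[OF assms] by linarith
  thus ?thesis by (simp add: jump_def success_prob_def)
qed

text \<open>The source of linearity: the success probability cancels the denominator of the jump.
  Where it is 0, physicality squeezes \<open>a k * (x - 1/4) + b k\<close> to 0, so both sides
  vanish.\<close>

lemma success_times_obs_jump:
  assumes "k \<in> {1..n}" "x \<in> {1/4..1}"
  shows "obs \<alpha> \<beta> (jump a b c d k x) * success_prob c d k x =
    \<alpha> * (c k * (x - 1/4) + d k) + \<beta> * (a k * (x - 1/4) + b k)"
proof (cases "success_prob c d k x = 0")
  case True
  thus ?thesis using physical_jump[OF assms] by (simp add: success_prob_def)
next
  case False
  have "jump a b c d k x > 0" using jump_range'[OF assms] by auto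
  hence "obs \<alpha> \<beta> (jump a b c d k x) = \<alpha> + \<beta> * ((a k * (x - 1/4) + b k) / success_prob c d k x)"
    by (simp add: obs_def jump_def success_prob_def)
  moreover have "(\<alpha> + \<beta> * (u / p)) * p = \<alpha> * p + \<beta> * u" if "p \<noteq> 0" for u p
    using that by (simp add: field_simps)
  ultimately show ?thesis using False by (simp add: success_prob_def[symmetric])
qed

lemma average_obs_jump:
  assumes F: "F t \<omega> \<in> {1/4..1}"
  defines "x \<equiv> decohere \<Gamma> (F t \<omega>)"
  shows "p_stay * obs \<alpha> \<beta> x + (\<Sum>k = 1..n. real (n choose k) * p_gen ^ k * (1 - p_gen) ^ (n - k) * p_try
     * (obs \<alpha> \<beta> (jump a b c d k x) * success_prob c d k x)) = next_obs \<alpha> \<beta> (F t \<omega>)"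
proof -
  have x: "x \<in> {1/4..1}" unfolding x_def by (rule decohere_range[OF F])
  have xe: "x - 1/4 = exp (-\<Gamma>) * (F t \<omega> - 1/4)" using F by (simp add: x_def decohere_def)
  have "(\<Sum>k = 1..n. real (n choose k) * p_gen ^ k * (1 - p_gen) ^ (n - k) * p_try
     * (obs \<alpha> \<beta> (jump a b c d k x) * success_prob c d k x)) =
     (\<Sum>k = 1..n. real (n choose k) * p_gen ^ k * (1 - p_gen) ^ (n - k) * p_try
     * (\<alpha> * (c k * (x - 1/4) + d k) + \<beta> * (a k * (x - 1/4) + b k)))"
    by (intro sum.cong refl) (simp only: success_times_obs_jump[OF _ x])
  also have "\<dots> = p_try * (\<alpha> * (binomial_average n p_gen c * (x - 1/4) + binomial_average n p_gen d)
      + \<beta> * (binomial_average n p_gen a * (x - 1/4) + binomial_average n p_gen b))"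
    unfolding binomial_average_def sum_distrib_left sum_distrib_right sum.distrib[symmetric]
    by (intro sum.cong refl) (simp add: algebra_simps)
  also have "p_stay * obs \<alpha> \<beta> x + \<dots> = next_obs \<alpha> \<beta> (F t \<omega>)"
    using x F unfolding obs_def next_obs_def xe m11_def m12_def m21_def m22_def
    by (simp add: algebra_simps)
  finally show ?thesis .
qed

text \<open>The Markov property in integrated form:
  \<open>next_obs \<alpha> \<beta> (F t \<omega>)\<close> acts as the conditional expectation of
  \<open>obs \<alpha> \<beta> (F (Suc t) \<omega>)\<close> given the past, tested against an
  arbitrary bounded \<open>G\<close>.\<close>

lemma expectation_step:
  assumes G: "G \<in> borel_measurable (field_of (past t))" and bG: "AE \<omega> in M. \<bar>G \<omega>\<bar> \<le> B"
  shows "expectation (\<lambda>\<omega>. G \<omega> * obs \<alpha> \<beta> (F (Suc t) \<omega>)) = expectation (\<lambda>\<omega>. G \<omega> * next_obs \<alpha> \<beta> (F t \<omega>))"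
proof -
  define T where "T = Suc t"
  have T: "T \<ge> 1" by (simp add: T_def)
  define C where "C = \<bar>\<alpha>\<bar> + \<bar>\<beta>\<bar>"
  define x where "x \<omega> = decohere \<Gamma> (F t \<omega>)" for \<omega>
  define H0 where "H0 \<omega> = G \<omega> * of_bool (F t \<omega> = 0) * obs \<alpha> \<beta> F_new" for \<omega>
  define H1 where "H1 \<omega> = G \<omega> * of_bool (F t \<omega> > 0) * obs \<alpha> \<beta> (x \<omega>)" for \<omega>
  define H where "H k \<omega> = G \<omega> * of_bool (F t \<omega> > 0) * obs \<alpha> \<beta> (jump a b c d k (x \<omega>))" for k \<omega>
  define P where "P k \<omega> = of_bool (F t \<omega> > 0) * success_prob c d k (x \<omega>)" for k \<omega>
  define Y0 :: "'a \<Rightarrow> real" where "Y0 \<omega> = of_bool (K T \<omega> \<ge> 1)" for \<omega>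
  define Y1 :: "'a \<Rightarrow> real" where "Y1 \<omega> = of_bool (\<not> X T \<omega>)" for \<omega>
  define Y2 :: "'a \<Rightarrow> real" where "Y2 \<omega> = of_bool (\<not> X T \<omega>) * (of_bool (K T \<omega> \<ge> 1) * of_bool (Q T \<omega>))" for \<omega>
  define Y :: "nat \<Rightarrow> 'a \<Rightarrow> real" where "Y k \<omega> = of_bool (\<not> X T \<omega>) * (of_bool (K T \<omega> = k) * of_bool (Q T \<omega>))" for k \<omega>
  define w where "w k = real (n choose k) * p_gen ^ k * (1 - p_gen) ^ (n - k)" for k
  \<comment> \<open>\<open>Purification\<close> is kept out of this block: the threshold for
    \<open>W T\<close> depends on the past, so \<open>W T\<close> has to be integrated out on its
    own.\<close>
  define now where "now = {Request, Generation, Decision} \<times> {T}"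
  note disj = now_def T_def
  have reg: "AE \<omega> in M. regular \<omega> \<and> \<bar>G \<omega>\<bar> \<le> B" using AE_regular bG by eventually_elim simp
  have Hm: "H0 \<in> borel_measurable (field_of (past t))" "H1 \<in> borel_measurable (field_of (past t))"
    "H k \<in> borel_measurable (field_of (past t))" "P k \<in> borel_measurable (field_of (past t))" for k
  proof -
    note [measurable] = measurable_F_field[of t] G
    have [measurable]: "x \<in> borel_measurable (field_of (past t))" unfolding x_def decohere_def by measurable
    show "H0 \<in> borel_measurable (field_of (past t))" unfolding H0_def of_bool_def by measurable
    show "H1 \<in> borel_measurable (field_of (past t))" unfolding H1_def obs_def of_bool_def by measurable
    show "H k \<in> borel_measurable (field_of (past t))" unfolding H_def obs_def jump_def of_bool_def by measurable
    show "P k \<in> borel_measurable (field_of (past t))" unfolding P_def success_prob_def of_bool_def by measurable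
  qed
  have Ym: "Y0 \<in> borel_measurable (field_of now)" "Y1 \<in> borel_measurable (field_of now)"
    "Y2 \<in> borel_measurable (field_of now)" "Y k \<in> borel_measurable (field_of now)" for k
  proof -
    have [measurable]: "X T \<in> measurable (field_of now) (count_space UNIV)"
      "K T \<in> measurable (field_of now) (count_space UNIV)" "Q T \<in> measurable (field_of now) (count_space UNIV)"
      by (auto intro!: measurable_X_field measurable_K_field measurable_Q_field simp: now_def)
    show "Y0 \<in> borel_measurable (field_of now)" unfolding Y0_def of_bool_def by measurable
    show "Y1 \<in> borel_measurable (field_of now)" unfolding Y1_def of_bool_def by measurable
    show "Y2 \<in> borel_measurable (field_of now)" unfolding Y2_def of_bool_def by measurable
    show "Y k \<in> borel_measurable (field_of now)" unfolding Y_def of_bool_def by measurable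
  qed
  have subs: "past t \<subseteq> UNIV \<times> {1..}" "now \<subseteq> UNIV \<times> {1..}" "past t \<inter> now = {}" by (auto simp: disj)
  have HM [measurable]: "H0 \<in> borel_measurable M" "H1 \<in> borel_measurable M" "H k \<in> borel_measurable M" "P k \<in> borel_measurable M" for k
    using Hm measurable_from_field subs(1) by blast+
  have YM [measurable]: "Y0 \<in> borel_measurable M" "Y1 \<in> borel_measurable M" "Y2 \<in> borel_measurable M" "Y k \<in> borel_measurable M" for k
    using Ym measurable_from_field subs(2) by blast+
  have WM [measurable]: "W T \<in> borel_measurable M" by (rule W_measurable[OF T])
  have bY: "AE \<omega> in M. \<bar>Y0 \<omega>\<bar> \<le> 1" "AE \<omega> in M. \<bar>Y1 \<omega>\<bar> \<le> 1" "AE \<omega> in M. \<bar>Y2 \<omega>\<bar> \<le> 1" "AE \<omega> in M. \<bar>Y k \<omega>\<bar> \<le> 1" for k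
    by (auto simp: Y0_def Y1_def Y2_def Y_def)
  have xr: "x \<omega> \<in> {1/4..1}" if "regular \<omega>" "F t \<omega> > 0" for \<omega>
    unfolding x_def using F_range[OF that(1), of t] that(2) decohere_range by auto
  have bH0: "AE \<omega> in M. \<bar>H0 \<omega>\<bar> \<le> B * \<bar>obs \<alpha> \<beta> F_new\<bar>"
    using reg by eventually_elim (auto simp: H0_def abs_mult intro!: mult_right_mono)
  have GC: "\<bar>G \<omega> * of_bool (F t \<omega> > 0) * y\<bar> \<le> B * C"
    if "\<bar>G \<omega>\<bar> \<le> B" "F t \<omega> > 0 \<Longrightarrow> \<bar>y\<bar> \<le> C" for \<omega> y
  proof -
    have "0 \<le> B" "0 \<le> C" using that(1) by (auto simp: C_def)
    thus ?thesis using that by (cases "F t \<omega> > 0") (auto simp: abs_mult intro!: mult_mono)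
  qed
  have bH1: "AE \<omega> in M. \<bar>H1 \<omega>\<bar> \<le> B * C"
    using reg
  proof eventually_elim
    case (elim \<omega>)
    show ?case unfolding H1_def
      by (rule GC) (use elim obs_le[OF xr, of \<omega> \<alpha> \<beta>] in \<open>auto simp: C_def\<close>)
  qed
  have bH: "AE \<omega> in M. \<bar>H k \<omega>\<bar> \<le> B * C" if k: "k \<in> {1..n}" for k
    using reg
  proof eventually_elim
    case (elim \<omega>)
    show ?case unfolding H_def
      by (rule GC) (use elim obs_le[OF jump_range'[OF k xr], of \<omega> \<alpha> \<beta>] in \<open>auto simp: C_def\<close>)
  qed
  have rP: "AE \<omega> in M. 0 \<le> P k \<omega> \<and> P k \<omega> \<le> 1" if k: "k \<in> {1..n}" for k
    using reg
  proof eventually_elim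
    case (elim \<omega>)
    show ?case using physical_prob[OF k xr, of \<omega>] elim by (auto simp: P_def)
  qed
  have int: "integrable M f" if "f \<in> borel_measurable M" "AE \<omega> in M. \<bar>f \<omega>\<bar> \<le> u" for f :: "'a \<Rightarrow> real" and u
    by (rule integrable_const_bound[where B = u]) (use that in auto)
  have bmult: "AE \<omega> in M. \<bar>f \<omega> * g \<omega>\<bar> \<le> u" if "AE \<omega> in M. \<bar>f \<omega>\<bar> \<le> u" "AE \<omega> in M. \<bar>g \<omega>\<bar> \<le> 1" for f g :: "'a \<Rightarrow> real" and u
    using that
  proof eventually_elim
    case (elim \<omega>)
    have "\<bar>f \<omega>\<bar> * \<bar>g \<omega>\<bar> \<le> u * 1" using elim by (intro mult_mono) auto
    thus ?case by (simp add: abs_mult)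
  qed
  define Z :: "nat \<Rightarrow> 'a \<Rightarrow> real" where "Z k \<omega> = of_bool (W T \<omega> < P k \<omega>)" for k \<omega>
  have ZM [measurable]: "Z k \<in> borel_measurable M" for k unfolding Z_def of_bool_def by measurable
  have bZ: "AE \<omega> in M. \<bar>Z k \<omega>\<bar> \<le> 1" for k by (auto simp: Z_def)
  have i0: "integrable M (\<lambda>\<omega>. H0 \<omega> * Y0 \<omega>)" by (rule int[OF _ bmult[OF bH0 bY(1)]]) measurable
  have i1: "integrable M (\<lambda>\<omega>. H1 \<omega> * Y1 \<omega>)" by (rule int[OF _ bmult[OF bH1 bY(2)]]) measurable
  have i2: "integrable M (\<lambda>\<omega>. H1 \<omega> * Y2 \<omega>)" by (rule int[OF _ bmult[OF bH1 bY(3)]]) measurable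
  have ik: "integrable M (\<lambda>\<omega>. H k \<omega> * Y k \<omega> * Z k \<omega>)" if "k \<in> {1..n}" for k
    by (rule int[OF _ bmult[OF bmult[OF bH[OF that] bY(4)] bZ]]) measurable
  have iS: "integrable M (\<lambda>\<omega>. \<Sum>k = 1..n. H k \<omega> * Y k \<omega> * Z k \<omega>)"
    by (intro Bochner_Integration.integrable_sum ik)
  have eS: "expectation (\<lambda>\<omega>. \<Sum>k = 1..n. H k \<omega> * Y k \<omega> * Z k \<omega>) = (\<Sum>k = 1..n. expectation (\<lambda>\<omega>. H k \<omega> * Y k \<omega> * Z k \<omega>))"
    by (rule Bochner_Integration.integral_sum[OF ik])
  have bP: "AE \<omega> in M. \<bar>P k \<omega>\<bar> \<le> 1" if "k \<in> {1..n}" for k using rP[OF that] by eventually_elim auto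
  have j0: "integrable M H0" by (rule int[OF _ bH0]) measurable
  have j1: "integrable M H1" by (rule int[OF _ bH1]) measurable
  have jk: "integrable M (\<lambda>\<omega>. H k \<omega> * P k \<omega>)" if "k \<in> {1..n}" for k
    by (rule int[OF _ bmult[OF bH[OF that] bP[OF that]]]) measurable
  have e0: "expectation (\<lambda>\<omega>. H0 \<omega> * Y0 \<omega>) = expectation H0 * (1 - p_none)"
    using expectation_mult_fields[OF subs(3,1,2) Hm(1) Ym(1) bH0 bY(1)] prob_K_ge_1[OF T]
    by (simp add: Y0_def p_none_def)
  have e1: "expectation (\<lambda>\<omega>. H1 \<omega> * Y1 \<omega>) = expectation H1 * (1 - p_con)"
    using expectation_mult_fields[OF subs(3,1,2) Hm(2) Ym(2) bH1 bY(2)]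
      expectation_X[OF T, of "\<lambda>b. of_bool (\<not> b)"] by (simp add: Y1_def)
  have e2: "expectation (\<lambda>\<omega>. H1 \<omega> * Y2 \<omega>) = expectation H1 * ((1 - p_con) * ((1 - p_none) * q))"
    using expectation_mult_fields[OF subs(3,1,2) Hm(2) Ym(3) bH1 bY(3)]
      expectation_XKQ[OF T, of "\<lambda>b. of_bool (\<not> b)" "\<lambda>k. k \<ge> 1" of_bool] prob_K_ge_1[OF T]
    by (simp add: Y2_def p_none_def)
  have ek: "expectation (\<lambda>\<omega>. H k \<omega> * Y k \<omega> * Z k \<omega>) = expectation (\<lambda>\<omega>. w k * p_try * (H k \<omega> * P k \<omega>))"
    if k: "k \<in> {1..n}" for k
  proof -
    \<comment> \<open>The uniform draw goes first, replaced by its success probability. What is left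
      is a variable of the past times one of the present.\<close>
    have "expectation (\<lambda>\<omega>. H k \<omega> * Y k \<omega> * Z k \<omega>) = expectation (\<lambda>\<omega>. H k \<omega> * Y k \<omega> * P k \<omega>)"
      unfolding Z_def
    proof (rule expectation_indep_uniform_less[OF indep_driver, where A = "past t \<union> now" and B = "{(Purification, T)}"])
      show "(past t \<union> now) \<inter> {(Purification, T)} = {}" by (auto simp: disj)
      show "past t \<union> now \<subseteq> UNIV \<times> {1..}" "{(Purification, T)} \<subseteq> UNIV \<times> {1..}" using subs T by auto
      show "(\<lambda>\<omega>. H k \<omega> * Y k \<omega>) \<in> borel_measurable (field_of (past t \<union> now))"
        by (intro borel_measurable_times measurable_generated_mono[OF Hm(3)] measurable_generated_mono[OF Ym(4)]) auto
      show "P k \<in> borel_measurable (field_of (past t \<union> now))"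
        by (rule measurable_generated_mono[OF Hm(4)]) auto
      show "W T \<in> borel_measurable (field_of {(Purification, T)})" by (rule measurable_W_field) simp
      show "distr M borel (W T) = uniform_measure lborel {0..1}" by (rule W_law[OF T])
      show "AE \<omega> in M. \<bar>H k \<omega> * Y k \<omega>\<bar> \<le> B * C" by (rule bmult[OF bH[OF k] bY(4)])
      show "AE \<omega> in M. 0 \<le> P k \<omega> \<and> P k \<omega> \<le> 1" by (rule rP[OF k])
    qed
    also have "\<dots> = expectation (\<lambda>\<omega>. (H k \<omega> * P k \<omega>) * Y k \<omega>)" by (simp add: mult_ac)
    also have "\<dots> = expectation (\<lambda>\<omega>. H k \<omega> * P k \<omega>) * expectation (Y k)"
      by (rule expectation_mult_fields[OF subs(3,1,2) _ Ym(4) bmult[OF bH[OF k] bP[OF k]] bY(4)])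
         (intro borel_measurable_times Hm)
    also have "expectation (Y k) = w k * p_try"
      unfolding Y_def[abs_def] expectation_XKQ[OF T, of "\<lambda>b. of_bool (\<not> b)" "\<lambda>j. j = k" of_bool]
        prob_K[OF T] w_def p_try_def by simp
    finally show ?thesis by simp
  qed
  have "expectation (\<lambda>\<omega>. G \<omega> * obs \<alpha> \<beta> (F (Suc t) \<omega>)) =
     expectation (\<lambda>\<omega>. H0 \<omega> * Y0 \<omega> + (H1 \<omega> * Y1 \<omega> - H1 \<omega> * Y2 \<omega>) + (\<Sum>k = 1..n. H k \<omega> * Y k \<omega> * Z k \<omega>))"
  proof (rule integral_cong_AE)
    have "G \<in> borel_measurable M" using G measurable_from_field subs(1) by blast
    thus "(\<lambda>\<omega>. G \<omega> * obs \<alpha> \<beta> (F (Suc t) \<omega>)) \<in> borel_measurable M" unfolding obs_def by measurable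
    show "AE \<omega> in M. G \<omega> * obs \<alpha> \<beta> (F (Suc t) \<omega>) = H0 \<omega> * Y0 \<omega> + (H1 \<omega> * Y1 \<omega> - H1 \<omega> * Y2 \<omega>) + (\<Sum>k = 1..n. H k \<omega> * Y k \<omega> * Z k \<omega>)"
      using reg
    proof eventually_elim
      case (elim \<omega>)
      show ?case
        unfolding step_expansion[OF elim[THEN conjunct1]] H0_def Y0_def H1_def Y1_def Y2_def H_def Y_def Z_def P_def x_def T_def
          distrib_left sum_distrib_left
        by (simp only: mult.assoc right_diff_distrib)
    qed
  qed measurable
  also have "\<dots> = expectation (\<lambda>\<omega>. H0 \<omega> * Y0 \<omega>) + (expectation (\<lambda>\<omega>. H1 \<omega> * Y1 \<omega>) - expectation (\<lambda>\<omega>. H1 \<omega> * Y2 \<omega>))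
      + (\<Sum>k = 1..n. expectation (\<lambda>\<omega>. H k \<omega> * Y k \<omega> * Z k \<omega>))"
    unfolding eS[symmetric] using i0 i1 i2 iS by simp
  also have "\<dots> = expectation (\<lambda>\<omega>. (1 - p_none) * H0 \<omega>) + expectation (\<lambda>\<omega>. p_stay * H1 \<omega>)
      + (\<Sum>k = 1..n. expectation (\<lambda>\<omega>. w k * p_try * (H k \<omega> * P k \<omega>)))"
  proof -
    have "(\<Sum>k = 1..n. expectation (\<lambda>\<omega>. H k \<omega> * Y k \<omega> * Z k \<omega>)) =
        (\<Sum>k = 1..n. expectation (\<lambda>\<omega>. w k * p_try * (H k \<omega> * P k \<omega>)))"
      by (intro sum.cong refl ek)
    moreover have "expectation H0 * (1 - p_none) + (expectation H1 * (1 - p_con) - expectation H1 * ((1 - p_con) * ((1 - p_none) * q)))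
        = (1 - p_none) * expectation H0 + p_stay * expectation H1"
      by (simp add: p_stay_def algebra_simps)
    ultimately show ?thesis unfolding e0 e1 e2 by simp
  qed
  also have "\<dots> = expectation (\<lambda>\<omega>. (1 - p_none) * H0 \<omega> + p_stay * H1 \<omega> + (\<Sum>k = 1..n. w k * p_try * (H k \<omega> * P k \<omega>)))"
  proof -
    have jk': "integrable M (\<lambda>\<omega>. w k * p_try * (H k \<omega> * P k \<omega>))" if "k \<in> {1..n}" for k
      by (intro integrable_mult_right jk that)
    have "integrable M (\<lambda>\<omega>. \<Sum>k = 1..n. w k * p_try * (H k \<omega> * P k \<omega>))"
      by (intro Bochner_Integration.integrable_sum jk')
    moreover have "expectation (\<lambda>\<omega>. \<Sum>k = 1..n. w k * p_try * (H k \<omega> * P k \<omega>)) =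
        (\<Sum>k = 1..n. expectation (\<lambda>\<omega>. w k * p_try * (H k \<omega> * P k \<omega>)))"
      by (rule Bochner_Integration.integral_sum[OF jk'])
    ultimately show ?thesis using j0 j1
      by (simp only: Bochner_Integration.integral_add Bochner_Integration.integrable_add integrable_mult_right)
  qed
  also have "\<dots> = expectation (\<lambda>\<omega>. G \<omega> * next_obs \<alpha> \<beta> (F t \<omega>))"
  proof (rule integral_cong_AE)
    have "G \<in> borel_measurable M" using G measurable_from_field subs(1) by blast
    thus "(\<lambda>\<omega>. G \<omega> * next_obs \<alpha> \<beta> (F t \<omega>)) \<in> borel_measurable M" unfolding next_obs_def by measurable
    show "AE \<omega> in M. (1 - p_none) * H0 \<omega> + p_stay * H1 \<omega> + (\<Sum>k = 1..n. w k * p_try * (H k \<omega> * P k \<omega>)) = G \<omega> * next_obs \<alpha> \<beta> (F t \<omega>)"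
      using reg
    proof eventually_elim
      case (elim \<omega>)
      show ?case
      proof (cases "F t \<omega> = 0")
        case True
        thus ?thesis using F_new by (simp add: H0_def H1_def H_def next_obs_def obs_def)
      next
        case False
        hence F: "F t \<omega> \<in> {1/4..1}" using F_range[of \<omega> t] elim by auto
        hence pos: "F t \<omega> > 0" by auto
        show ?thesis
          unfolding average_obs_jump[OF F, symmetric] H0_def H1_def H_def P_def x_def w_def
          using pos by (simp add: distrib_left sum_distrib_left mult_ac)
      qed
    qed
  qed measurable
  finally show ?thesis .
qed

end

section \<open>Averages along the request times\<close>

lemma sum_enumerate:
  fixes f :: "nat \<Rightarrow> real"
  assumes S: "infinite {t. t \<ge> 1 \<and> P t}"
  defines "e \<equiv> enumerate {t. t \<ge> 1 \<and> P t}"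
  shows "(\<Sum>j<m. f (e j)) = (\<Sum>t<e m - 1. of_bool (P (Suc t)) * f (Suc t))"
proof -
  define S where "S = {t. t \<ge> 1 \<and> P t}"
  have inf: "infinite S" using S by (simp add: S_def)
  have inS: "e j \<in> S" for j unfolding e_def S_def[symmetric] by (rule enumerate_in_set[OF inf])
  have mono: "strict_mono e" unfolding e_def S_def[symmetric] by (rule strict_mono_enumerate[OF inf])
  have "e ` {..<m} = {s \<in> S. s < e m}"
  proof safe
    fix s assume "s \<in> S" "s < e m"
    then obtain j where "s = e j" using enumerate_Ex[of S s] inf unfolding e_def S_def by metis
    thus "s \<in> e ` {..<m}" using \<open>s < e m\<close> mono by (auto simp: strict_mono_less)
  qed (use inS mono in \<open>auto simp: strict_mono_less\<close>)
  moreover have "inj_on e {..<m}" using mono by (metis inj_on_subset strict_mono_imp_inj_on subset_UNIV)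
  ultimately have "(\<Sum>j<m. f (e j)) = sum f {s \<in> S. s < e m}"
    by (metis (no_types, lifting) sum.reindex_cong)
  \<comment> \<open>Since \<open>enumerate\<close> counts from 0, the first \<open>m\<close>
    requests are those at times below \<open>e m\<close>; written as \<open>Suc t\<close>, they have
    \<open>t < e m - 1\<close>.\<close>
  also have "{s \<in> S. s < e m} = Suc ` {t. t < e m - 1 \<and> P (Suc t)}"
  proof safe
    fix s assume "s \<in> S" "s < e m"
    thus "s \<in> Suc ` {t. t < e m - 1 \<and> P (Suc t)}" by (cases s) (auto simp: S_def)
  qed (auto simp: S_def)
  also have "sum f \<dots> = (\<Sum>t | t < e m - 1 \<and> P (Suc t). f (Suc t))"
    by (subst sum.reindex) auto
  also have "\<dots> = (\<Sum>t<e m - 1. of_bool (P (Suc t)) * f (Suc t))"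
    by (rule sum.mono_neutral_cong_left) auto
  finally show ?thesis .
qed

text \<open>Both time averages are read along the times just before request \<open>m\<close>,
  counted from 0. There the request count is exactly \<open>m\<close>, and the quotient of the two
  averages is the average over requests.\<close>

lemma average_along_enumerate:
  fixes f :: "nat \<Rightarrow> real"
  assumes S: "infinite {t. t \<ge> 1 \<and> P t}"
    and p: "(\<lambda>N. (\<Sum>t<N. of_bool (P (Suc t))) / real N) \<longlonglongrightarrow> p" "p \<noteq> 0"
    and r: "(\<lambda>N. (\<Sum>t<N. of_bool (P (Suc t)) * f (Suc t)) / real N) \<longlonglongrightarrow> r"
  shows "(\<lambda>m. 1 / real m * (\<Sum>j = 1..m. f (enumerate {t. t \<ge> 1 \<and> P t} (j - 1)))) \<longlonglongrightarrow> r / p"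
proof -
  define e where "e = enumerate {t. t \<ge> 1 \<and> P t}"
  define N where "N m = e m - 1" for m
  have "filterlim N at_top at_top"
    unfolding filterlim_at_top
  proof
    fix Z
    have "Z \<le> N m" if "Suc Z \<le> m" for m
      using le_enumerate[OF S, of m] that by (simp add: N_def e_def)
    thus "eventually (\<lambda>m. Z \<le> N m) at_top" by (rule eventually_sequentiallyI)
  qed
  from filterlim_compose[OF tendsto_divide[OF r p] this]
  have lim: "(\<lambda>m. (\<Sum>t<N m. of_bool (P (Suc t)) * f (Suc t)) / real (N m) /
        ((\<Sum>t<N m. of_bool (P (Suc t))) / real (N m))) \<longlonglongrightarrow> r / p" .
  have m: "(\<Sum>t<N m. of_bool (P (Suc t))) = real m" for m
    using sum_enumerate[OF S, of "\<lambda>_. 1" m] by (simp add: N_def e_def)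
  have Npos: "N m > 0" if "m > 0" for m
    using m[of m] that by (cases "N m") auto
  show ?thesis
  proof (rule Lim_transform_eventually[OF lim])
    show "eventually (\<lambda>m. (\<Sum>t<N m. of_bool (P (Suc t)) * f (Suc t)) / real (N m) /
        ((\<Sum>t<N m. of_bool (P (Suc t))) / real (N m)) =
        1 / real m * (\<Sum>j = 1..m. f (enumerate {t. t \<ge> 1 \<and> P t} (j - 1)))) sequentially"
    proof (rule eventually_sequentiallyI[of 1])
      fix k :: nat assume "1 \<le> k"
      have "(\<Sum>j = 1..k. f (e (j - 1))) = (\<Sum>j<k. f (e j))"
        by (rule sum.reindex_bij_witness[of _ Suc "\<lambda>j. j - 1"]) auto
      also have "\<dots> = (\<Sum>t<N k. of_bool (P (Suc t)) * f (Suc t))"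
        unfolding N_def e_def by (rule sum_enumerate[OF S])
      finally show "(\<Sum>t<N k. of_bool (P (Suc t)) * f (Suc t)) / real (N k) /
        ((\<Sum>t<N k. of_bool (P (Suc t))) / real (N k)) =
        1 / real k * (\<Sum>j = 1..k. f (enumerate {t. t \<ge> 1 \<and> P t} (j - 1)))"
        unfolding m using Npos[of k] \<open>1 \<le> k\<close> by (simp add: e_def)
    qed
  qed
qed

section \<open>Physicality bounds and inversion of the step matrix\<close>

context link_1GnB
begin

lemma p_none: "0 \<le> p_none" "p_none < 1"
  using p_gen n_ge_1 by (auto simp: p_none_def power_less_one_iff)

lemma p_stay_plus_p_try: "p_stay + p_try * (1 - p_none) = 1 - p_con"
  by (simp add: p_stay_def p_try_def algebra_simps)

lemma p_stay_try_nonneg: "0 \<le> p_stay" "0 \<le> p_try"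
  using p_none p_con q by (auto simp: p_stay_def p_try_def)

lemma binomial_average_linear:
  "binomial_average n p_gen u * z + binomial_average n p_gen v = binomial_average n p_gen (\<lambda>k. u k * z + v k)"
  unfolding binomial_average_def sum_distrib_right sum.distrib[symmetric]
  by (intro sum.cong refl) (simp add: algebra_simps)

lemma binomial_average_mono:
  assumes "\<And>k. k \<in> {1..n} \<Longrightarrow> u k \<le> v k"
  shows "binomial_average n p_gen u \<le> binomial_average n p_gen v"
  unfolding binomial_average_def using assms p_gen
  by (intro sum_mono mult_right_mono) auto

lemma binomial_average_const: "binomial_average n p_gen (\<lambda>_. r) = r * (1 - p_none)"
proof -
  have "(\<Sum>k\<le>n. real (n choose k) * p_gen ^ k * (1 - p_gen) ^ (n - k)) = 1"
    using binomial_ring[of p_gen "1 - p_gen" n] by simp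
  hence "(\<Sum>k = 1..n. real (n choose k) * p_gen ^ k * (1 - p_gen) ^ (n - k)) = 1 - p_none"
    by (simp add: sum.atMost_shift atMost_atLeast0 sum.atLeast_Suc_atMost p_none_def)
  moreover have "binomial_average n p_gen (\<lambda>_. r) =
      r * (\<Sum>k = 1..n. real (n choose k) * p_gen ^ k * (1 - p_gen) ^ (n - k))"
    unfolding binomial_average_def sum_distrib_left by (intro sum.cong refl) (simp add: mult_ac)
  ultimately show ?thesis by simp
qed

text \<open>Physicality averaged over \<open>K >= 1\<close>, an event of probability
  \<open>1 - p_none\<close>, constrains the four averages of the policy at every \<open>z\<close>
  that a fidelity can produce.\<close>

lemma average_bounds:
  assumes z: "z \<in> {0..3/4}"
  defines "u \<equiv> binomial_average n p_gen a * z + binomial_average n p_gen b"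
    and "v \<equiv> binomial_average n p_gen c * z + binomial_average n p_gen d"
  shows "0 \<le> u" "u \<le> 3/4 * v" "v \<le> 1 - p_none"
proof -
  have x: "z + 1/4 \<in> {1/4..1}" using z by auto
  have ph: "0 \<le> a k * z + b k" "a k * z + b k \<le> 3/4 * (c k * z + d k)" "c k * z + d k \<le> 1"
    if "k \<in> {1..n}" for k
    using physical_jump[OF that x] physical_prob[OF that x] by (auto simp: success_prob_def)
  show "0 \<le> u"
    unfolding u_def binomial_average_linear using binomial_average_mono[of "\<lambda>_. 0"] ph(1)
    by (simp add: binomial_average_const)
  have "3/4 * v = binomial_average n p_gen (\<lambda>k. 3/4 * (c k * z + d k))"
    unfolding v_def binomial_average_linear unfolding binomial_average_def sum_distrib_left
    by (intro sum.cong refl) (simp add: mult_ac)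
  thus "u \<le> 3/4 * v"
    unfolding u_def binomial_average_linear using binomial_average_mono ph(2) by presburger
  show "v \<le> 1 - p_none"
    unfolding v_def binomial_average_linear using binomial_average_mono[of _ "\<lambda>_. 1"] ph(3)
    by (simp add: binomial_average_const)
qed

definition m_det :: real where "m_det = (1 - m11) * (1 - m22) - m12 * m21"

lemma exp_Gamma: "0 < exp (- \<Gamma>)" "exp (- \<Gamma>) \<le> 1"
  using \<Gamma> by auto

text \<open>Each bound comes from a step out of an extreme state. The first and third start at z =
  0, the others at z = 3/4, which decoheres to 3/4 e^(-\<Gamma>). The last says that the new z is at
  most 3/4 while the memory is occupied.\<close>

lemma m_bounds:
  "m11 \<le> 1 - p_con" "m11 + 3/4 * m12 \<le> 1 - p_con" "0 \<le> m21" "m22 + 4/3 * m21 \<le> m11 + 3/4 * m12"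
proof -
  define e where "e = exp (- \<Gamma>)"
  have e: "3/4 * e \<in> {0..3/4}" using exp_Gamma by (auto simp: e_def)
  note b0 = average_bounds[of 0, simplified] and be = average_bounds[OF e]
  show "m11 \<le> 1 - p_con"
    using mult_left_mono[OF b0(3) p_stay_try_nonneg(2)] p_stay_plus_p_try by (simp add: m11_def)
  show "m11 + 3/4 * m12 \<le> 1 - p_con"
    using mult_left_mono[OF be(3) p_stay_try_nonneg(2)] p_stay_plus_p_try
    by (simp add: m11_def m12_def e_def algebra_simps)
  show "0 \<le> m21" using b0(1) p_stay_try_nonneg by (simp add: m21_def)
  have "e * p_stay \<le> 1 * p_stay" using exp_Gamma p_stay_try_nonneg by (intro mult_right_mono) (auto simp: e_def)
  thus "m22 + 4/3 * m21 \<le> m11 + 3/4 * m12"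
    using mult_left_mono[OF be(2) p_stay_try_nonneg(2)]
    by (simp add: m11_def m12_def m21_def m22_def e_def[symmetric] algebra_simps)
qed

text \<open>For \<open>m12 >= 0\<close>, \<open>m_bounds\<close> puts the diagonal entries of
  identity minus the matrix at or above p_con + 3/4 \<open>m12\<close> and p_con + 4/3
  \<open>m21\<close>: diagonal dominance once z is scaled to [0, 1]. For \<open>m12 < 0\<close>,
  when survival is less likely at higher fidelity, the product \<open>m12 * m21\<close> is not
  positive.\<close>

lemma m_det_pos: "0 < m_det"
proof (cases "m12 \<ge> 0")
  case True
  have "m12 * m21 = (3/4 * m12) * (4/3 * m21)" by simp
  also have "\<dots> < (p_con + 3/4 * m12) * (p_con + 4/3 * m21)"
    using True m_bounds p_con by (intro mult_strict_mono) auto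
  also have "\<dots> \<le> (1 - m11) * (1 - m22)"
    using True m_bounds p_con by (intro mult_mono) auto
  finally show ?thesis by (simp add: m_det_def)
next
  case False
  have "p_con * p_con \<le> (1 - m11) * (1 - m22)"
    using False m_bounds p_con by (intro mult_mono) auto
  moreover have "0 < p_con * p_con" using p_con by simp
  moreover have "m12 * m21 \<le> 0" using False m_bounds by (simp add: mult_nonpos_nonneg)
  ultimately show ?thesis unfolding m_det_def by linarith
qed

definition mean_occ :: real where
  "mean_occ = (1 - m22 + m12 * (F_new - 1/4)) / m_det"

text \<open>The numerator is affine in \<open>F_new\<close>, so the values at 1/4 and 1 decide. At 1
  the fourth of the \<open>m_bounds\<close> absorbs the term 3/4 \<open>m12\<close>.\<close>

lemma mean_occ_pos: "0 < mean_occ"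
proof -
  have "0 < 1 - m22 + m12 * (F_new - 1/4)"
  proof (cases "m12 \<ge> 0")
    case True
    have "0 \<le> m12 * (F_new - 1/4)" using True F_new by simp
    moreover have "m22 < 1" using m_bounds p_con by linarith
    ultimately show ?thesis by simp
  next
    case False
    have "m12 * (3/4) \<le> m12 * (F_new - 1/4)" using False F_new by (intro mult_left_mono_neg) auto
    moreover have "0 < 1 - m22 + m12 * (3/4)" using m_bounds p_con by linarith
    ultimately show ?thesis by simp
  qed
  thus ?thesis using m_det_pos by (simp add: mean_occ_def)
qed

text \<open>\<open>rem1 + rem2 (x - 1/4)\<close> is the expected time until a memory of fidelity \<open>x\<close> is emptied.\<close>

definition rem1 :: real where "rem1 = (1 - m22) / m_det"
definition rem2 :: real where "rem2 = m12 / m_det"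

text \<open>First-step analysis: the row vector (\<open>rem1\<close>, \<open>rem2\<close>) times
  identity minus the step matrix is (1, 0), where the 1 counts the current step. The definitions are
  Cramer's rule for this system.\<close>

lemma rem_eqs:
  "rem1 * m11 + rem2 * m21 = rem1 - 1" "rem1 * m12 + rem2 * m22 = rem2"
  "rem1 + rem2 * (F_new - 1/4) = mean_occ"
proof -
  have "(1 - m22) * m11 + m12 * m21 = 1 - m22 - m_det" by (simp add: m_det_def algebra_simps)
  thus "rem1 * m11 + rem2 * m21 = rem1 - 1"
    using m_det_pos by (simp add: rem1_def rem2_def divide_simps)
  show "rem1 * m12 + rem2 * m22 = rem2"
    using m_det_pos by (simp add: rem1_def rem2_def divide_simps) (simp add: algebra_simps)
  show "rem1 + rem2 * (F_new - 1/4) = mean_occ"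
    unfolding rem1_def rem2_def mean_occ_def by (simp add: add_divide_distrib)
qed

text \<open>The scale \<open>r\<close> is 1 for the cycle lengths and \<open>1 - busy_rate\<close>
  for the Poisson equation.\<close>

lemma next_obs_rem:
  "next_obs (r * rem1) (r * rem2) x =
     (if x > 0 then obs (r * rem1) (r * rem2) x - r else r * ((1 - p_none) * mean_occ))"
proof -
  have "r * rem1 * (m11 + m12 * z) + r * rem2 * (m21 + m22 * z) =
    r * (rem1 * m11 + rem2 * m21) + r * (rem1 * m12 + rem2 * m22) * z" for z
    by (simp add: algebra_simps)
  moreover have "r * rem1 + r * rem2 * (F_new - 1/4) = r * mean_occ"
    unfolding rem_eqs(3)[symmetric] by (simp add: algebra_simps)
  ultimately show ?thesis unfolding next_obs_def obs_def by (simp only: rem_eqs) (simp add: algebra_simps)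
qed

end

section \<open>Long-run averages\<close>

text \<open>A budget: \<open>s\<close> is a bounded stock, \<open>x\<close> the nonnegative outflow
  and \<open>e\<close> an inflow of finite total. The total outflow is then bounded, and it is known
  exactly once the stock is seen to run out.\<close>

lemma summable_telescoping:
  fixes x s e :: "nat \<Rightarrow> real"
  assumes rec: "\<And>t. s (Suc t) = s t - x t + e t" and x: "\<And>t. 0 \<le> x t"
    and s: "\<And>t. \<bar>s t\<bar> \<le> B" and e: "summable e"
  shows "summable x"
proof -
  have sum: "(\<Sum>t<N. x t) = s 0 - s N + (\<Sum>t<N. e t)" for N
    by (induction N) (auto simp: rec)
  have "Bseq (\<lambda>N. \<Sum>t<N. e t)" using summable_LIMSEQ[OF e] by (intro convergent_imp_Bseq) (auto simp: convergent_def)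
  then obtain C where C: "\<And>N. \<bar>\<Sum>t<N. e t\<bar> \<le> C" by (auto simp: Bseq_def)
  show ?thesis
  proof (rule bounded_imp_summable[OF x])
    fix N
    have "(\<Sum>t\<le>N. x t) = s 0 - s (Suc N) + (\<Sum>t<Suc N. e t)"
      using sum[of "Suc N"] by (simp only: lessThan_Suc_atMost)
    thus "(\<Sum>t\<le>N. x t) \<le> 2 * B + C" using s[of 0] s[of "Suc N"] C[of "Suc N"] by linarith
  qed
qed

lemma suminf_telescoping:
  fixes x s e :: "nat \<Rightarrow> real"
  assumes rec: "\<And>t. s (Suc t) = s t - x t + e t" and s: "s \<longlonglongrightarrow> 0" and e: "summable e"
  shows "(\<Sum>t. x t) = s 0 + (\<Sum>t. e t)"
proof -
  have sum: "(\<Sum>t<N. x t) = s 0 - s N + (\<Sum>t<N. e t)" for N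
    by (induction N) (auto simp: rec)
  have "(\<lambda>N. \<Sum>t<N. x t) \<longlonglongrightarrow> s 0 - 0 + (\<Sum>t. e t)"
    unfolding sum by (intro tendsto_intros s summable_LIMSEQ[OF e])
  hence "x sums (s 0 + (\<Sum>t. e t))" by (simp add: sums_def)
  thus ?thesis by (simp add: sums_iff)
qed

context link_1GnB
begin

definition busy :: "nat \<Rightarrow> 'a \<Rightarrow> real" where "busy t \<omega> = of_bool (F t \<omega> > 0)"

text \<open>A centred request times a variable of its past is a martingale difference.
  \<open>J = 1\<close> gives the frequency of requests, \<open>J = busy\<close> that requests see
  time averages.\<close>

lemma AE_request_average:
  assumes J: "\<And>t. J t \<in> borel_measurable (field_of (past t))" and b: "\<And>t. AE \<omega> in M. \<bar>J t \<omega>\<bar> \<le> 1"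
  shows "AE \<omega> in M. (\<lambda>N. (\<Sum>t<N. (of_bool (X (Suc t) \<omega>) - p_con) * J t \<omega>) / real N) \<longlonglongrightarrow> 0"
proof (rule orthogonal_average_tendsto_0[where c = 1])
  define Y where "Y t \<omega> = of_bool (X (Suc t) \<omega>) - p_con" for t \<omega>
  have Ym: "Y t \<in> borel_measurable (field_of {(Request, Suc t)})" for t
    unfolding Y_def by (rule measurable_compose[OF measurable_X_field]) auto
  have bY: "\<bar>Y t \<omega>\<bar> \<le> 1" for t \<omega> using p_con by (auto simp: Y_def of_bool_def)
  have JM: "J t \<in> borel_measurable M" for t by (rule measurable_from_field[OF J]) auto
  have YM: "Y t \<in> borel_measurable M" for t by (rule measurable_from_field[OF Ym]) auto
  show "(\<lambda>\<omega>. (of_bool (X (Suc t) \<omega>) - p_con) * J t \<omega>) \<in> borel_measurable M" for t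
    using borel_measurable_times[OF YM JM] by (simp add: Y_def)
  have bYJ: "AE \<omega> in M. \<bar>Y t \<omega> * J t \<omega>\<bar> \<le> 1" for t
    using b[of t]
  proof eventually_elim
    case (elim \<omega>)
    have "\<bar>Y t \<omega>\<bar> * \<bar>J t \<omega>\<bar> \<le> 1 * 1" using elim bY by (intro mult_mono) auto
    thus ?case by (simp add: abs_mult)
  qed
  thus "AE \<omega> in M. \<bar>(of_bool (X (Suc t) \<omega>) - p_con) * J t \<omega>\<bar> \<le> 1" for t
    by (simp add: Y_def)
  fix s t :: nat assume st: "s < t"
  \<comment> \<open>Since \<open>s < t\<close>, every factor but the last request belongs to
    \<open>past t\<close>, and that request has mean 0 after centring.\<close>
  have "expectation (\<lambda>\<omega>. (Y s \<omega> * J s \<omega>) * (Y t \<omega> * J t \<omega>)) = expectation (\<lambda>\<omega>. (Y s \<omega> * J s \<omega> * J t \<omega>) * Y t \<omega>)"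
    by (simp add: mult_ac)
  also have "\<dots> = expectation (\<lambda>\<omega>. Y s \<omega> * J s \<omega> * J t \<omega>) * expectation (Y t)"
  proof (rule expectation_mult_fields[OF _ _ _ _ Ym])
    show "past t \<inter> {(Request, Suc t)} = {}" by auto
    show "past t \<subseteq> UNIV \<times> {1..}" "{(Request, Suc t)} \<subseteq> UNIV \<times> {1..}" by auto
    show "(\<lambda>\<omega>. Y s \<omega> * J s \<omega> * J t \<omega>) \<in> borel_measurable (field_of (past t))"
      by (intro borel_measurable_times J measurable_generated_mono[OF J] measurable_generated_mono[OF Ym])
         (use st in auto)
    show "AE \<omega> in M. \<bar>Y s \<omega> * J s \<omega> * J t \<omega>\<bar> \<le> 1"
      using bYJ[of s] b[of t]
    proof eventually_elim
      case (elim \<omega>)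
      have "\<bar>Y s \<omega> * J s \<omega>\<bar> * \<bar>J t \<omega>\<bar> \<le> 1 * 1" using elim by (intro mult_mono) auto
      thus ?case by (simp add: abs_mult)
    qed
    show "AE \<omega> in M. \<bar>Y t \<omega>\<bar> \<le> 1" using bY by simp
  qed
  also have "expectation (Y t) = 0"
    unfolding Y_def[abs_def] using expectation_X[of "Suc t" "\<lambda>b. of_bool b - p_con"]
    by (simp add: algebra_simps)
  finally show "expectation (\<lambda>\<omega>. ((of_bool (X (Suc s) \<omega>) - p_con) * J s \<omega>) * ((of_bool (X (Suc t) \<omega>) - p_con) * J t \<omega>)) = 0"
    by (simp add: Y_def)
qed

lemma borel_measurable_obs [measurable]: "obs \<alpha> \<beta> \<in> borel_measurable borel"
  unfolding obs_def[abs_def] by measurable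

lemma borel_measurable_next_obs [measurable]: "next_obs \<alpha> \<beta> \<in> borel_measurable borel"
  unfolding next_obs_def[abs_def] by measurable

definition busy_rate :: real where
  "busy_rate = mean_occ / (1 / (1 - p_none) + mean_occ)"

lemma busy_rate_pos: "0 < busy_rate"
  using mean_occ_pos p_none by (auto simp: busy_rate_def intro!: divide_pos_pos add_pos_pos)

text \<open>What determines \<open>busy_rate\<close>: it makes the drift out of the empty memory
  equal to the mean that is subtracted from \<open>busy\<close>.\<close>

lemma busy_rate_balance: "(1 - busy_rate) * ((1 - p_none) * mean_occ) = busy_rate"
proof -
  have "1 / (1 - p_none) + mean_occ > 0" using mean_occ_pos p_none by (intro add_pos_pos) auto
  hence "1 - busy_rate = (1 / (1 - p_none)) / (1 / (1 - p_none) + mean_occ)"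
    by (simp add: busy_rate_def field_simps)
  thus ?thesis using p_none by (simp add: busy_rate_def)
qed

text \<open>Poisson equation: up to the factor \<open>1 - busy_rate\<close>, \<open>obs rem1 rem2\<close> is the expected remaining
  time until the memory is emptied, so its drift compensates \<open>busy - busy_rate\<close>.\<close>

lemma poisson_equation:
  assumes "regular \<omega>"
  shows "next_obs ((1 - busy_rate) * rem1) ((1 - busy_rate) * rem2) (F t \<omega>) =
    obs ((1 - busy_rate) * rem1) ((1 - busy_rate) * rem2) (F t \<omega>) - (busy t \<omega> - busy_rate)"
  unfolding next_obs_rem busy_rate_balance using F_nonneg[OF assms, of t] by (auto simp: busy_def obs_def)

lemma AE_busy_average:
  "AE \<omega> in M. (\<lambda>N. (\<Sum>t<N. busy t \<omega>) / real N) \<longlonglongrightarrow> busy_rate"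
proof -
  define \<alpha> \<beta> where "\<alpha> = (1 - busy_rate) * rem1" and "\<beta> = (1 - busy_rate) * rem2"
  define D where "D t \<omega> = obs \<alpha> \<beta> (F (Suc t) \<omega>) - next_obs \<alpha> \<beta> (F t \<omega>)" for t \<omega>
  obtain B where B: "\<And>\<omega> t. regular \<omega> \<Longrightarrow> \<bar>next_obs \<alpha> \<beta> (F t \<omega>)\<bar> \<le> B"
    using next_obs_bound by blast
  define C where "C = \<bar>\<alpha>\<bar> + \<bar>\<beta>\<bar>"
  have C: "regular \<omega> \<Longrightarrow> \<bar>obs \<alpha> \<beta> (F t \<omega>)\<bar> \<le> C" for \<omega> t unfolding C_def by (rule obs_bound)
  have Db: "AE \<omega> in M. \<bar>D t \<omega>\<bar> \<le> C + B" for t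
    using AE_regular
  proof eventually_elim
    case (elim \<omega>)
    show ?case using B[OF elim, of t] C[OF elim, of "Suc t"] by (simp add: D_def)
  qed
  have Dm: "D s \<in> borel_measurable (field_of (past t))" if "s < t" for s t
    unfolding D_def using that
    by (intro borel_measurable_diff measurable_compose[OF _ borel_measurable_obs]
        measurable_compose[OF _ borel_measurable_next_obs] measurable_generated_mono[OF measurable_F_field]) auto
  have DM: "D s \<in> borel_measurable M" for s
    by (rule measurable_from_field[OF Dm[of s "Suc s"]]) auto
  have FM: "(\<lambda>\<omega>. obs \<alpha> \<beta> (F t \<omega>)) \<in> borel_measurable M" "(\<lambda>\<omega>. next_obs \<alpha> \<beta> (F t \<omega>)) \<in> borel_measurable M" for t
    by measurable
  have "AE \<omega> in M. (\<lambda>N. (\<Sum>t<N. D t \<omega>) / real N) \<longlonglongrightarrow> 0"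
  proof (rule orthogonal_average_tendsto_0[OF DM Db])
    fix s t :: nat assume st: "s < t"
    have i: "integrable M (\<lambda>\<omega>. D s \<omega> * obs \<alpha> \<beta> (F (Suc t) \<omega>))"
    proof (rule integrable_const_bound[where B = "(C + B) * C"])
      show "AE \<omega> in M. norm (D s \<omega> * obs \<alpha> \<beta> (F (Suc t) \<omega>)) \<le> (C + B) * C"
        using Db[of s] AE_regular
        by eventually_elim (auto simp: abs_mult intro!: mult_mono C order.trans[OF abs_ge_zero])
    qed (intro borel_measurable_times DM FM)
    have j: "integrable M (\<lambda>\<omega>. D s \<omega> * next_obs \<alpha> \<beta> (F t \<omega>))"
    proof (rule integrable_const_bound[where B = "(C + B) * B"])
      show "AE \<omega> in M. norm (D s \<omega> * next_obs \<alpha> \<beta> (F t \<omega>)) \<le> (C + B) * B"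
        using Db[of s] AE_regular
        by eventually_elim (auto simp: abs_mult intro!: mult_mono B order.trans[OF abs_ge_zero])
    qed (intro borel_measurable_times DM FM)
    have "expectation (\<lambda>\<omega>. D s \<omega> * D t \<omega>) =
      expectation (\<lambda>\<omega>. D s \<omega> * obs \<alpha> \<beta> (F (Suc t) \<omega>) - D s \<omega> * next_obs \<alpha> \<beta> (F t \<omega>))"
      by (simp add: D_def[of t] right_diff_distrib)
    also have "\<dots> = 0"
      unfolding Bochner_Integration.integral_diff[OF i j] expectation_step[OF Dm[OF st] Db] by simp
    finally show "expectation (\<lambda>\<omega>. D s \<omega> * D t \<omega>) = 0" .
  qed
  with AE_regular show ?thesis
  proof eventually_elim
    case (elim \<omega>)
    define y where "y t = obs \<alpha> \<beta> (F t \<omega>)" for t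
    have drift: "D t \<omega> = y (Suc t) - y t + (busy t \<omega> - busy_rate)" for t
      unfolding D_def y_def \<alpha>_def \<beta>_def poisson_equation[OF elim(1)] by simp
    have sum: "(\<Sum>t<N. D t \<omega>) = y N - y 0 + (\<Sum>t<N. busy t \<omega>) - real N * busy_rate" for N
      by (induction N) (simp_all add: drift algebra_simps)
    have lim0: "(\<lambda>N. (y N - y 0) / real N) \<longlonglongrightarrow> 0"
    proof (rule Lim_null_comparison[OF always_eventually lim_const_over_n[of "2 * C"]])
      have "\<bar>y N - y 0\<bar> \<le> 2 * C" for N
        using C[OF elim(1), of N] C[OF elim(1), of 0] unfolding y_def by linarith
      thus "\<forall>N. norm ((y N - y 0) / real N) \<le> 2 * C / real N"
        by (auto intro!: divide_right_mono)
    qed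
    have "(\<lambda>N. (\<Sum>t<N. D t \<omega>) / real N - (y N - y 0) / real N + busy_rate) \<longlonglongrightarrow> 0 - 0 + busy_rate"
      by (intro tendsto_intros elim lim0)
    hence "(\<lambda>N. (\<Sum>t<N. D t \<omega>) / real N - (y N - y 0) / real N + busy_rate) \<longlonglongrightarrow> busy_rate" by simp
    thus ?case
    proof (rule Lim_transform_eventually)
      \<comment> \<open>At N = 0 division by 0 gives \<open>busy_rate\<close> on the left and 0 on
        the right, hence only from 1 on.\<close>
      show "\<forall>\<^sub>F N in sequentially. (\<Sum>t<N. D t \<omega>) / real N - (y N - y 0) / real N + busy_rate = (\<Sum>t<N. busy t \<omega>) / real N"
        by (rule eventually_sequentiallyI[of 1]) (simp add: sum field_simps)
    qed
  qed
qed

lemma AE_averages: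
  "AE \<omega> in M. regular \<omega>
    \<and> (\<lambda>N. (\<Sum>t<N. of_bool (X (Suc t) \<omega>)) / real N) \<longlonglongrightarrow> p_con
    \<and> (\<lambda>N. (\<Sum>t<N. of_bool (X (Suc t) \<omega>) * busy t \<omega>) / real N) \<longlonglongrightarrow> p_con * busy_rate
    \<and> (\<lambda>N. (\<Sum>t<N. busy t \<omega>) / real N) \<longlonglongrightarrow> busy_rate"
proof -
  have bm: "busy t \<in> borel_measurable (field_of (past t))" for t
  proof -
    note [measurable] = measurable_F_field[of t]
    show ?thesis unfolding busy_def of_bool_def by measurable
  qed
  have 1: "AE \<omega> in M. (\<lambda>N. (\<Sum>t<N. (of_bool (X (Suc t) \<omega>) - p_con) * 1) / real N) \<longlonglongrightarrow> 0"
    by (rule AE_request_average) auto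
  have 2: "AE \<omega> in M. (\<lambda>N. (\<Sum>t<N. (of_bool (X (Suc t) \<omega>) - p_con) * busy t \<omega>) / real N) \<longlonglongrightarrow> 0"
    by (rule AE_request_average[OF bm]) (auto simp: busy_def)
  show ?thesis
    using AE_regular 1 2 AE_busy_average
  proof eventually_elim
    case (elim \<omega>)
    have "(\<lambda>N. (\<Sum>t<N. (of_bool (X (Suc t) \<omega>) - p_con) * 1) / real N + p_con) \<longlonglongrightarrow> 0 + p_con"
      by (intro tendsto_intros elim)
    hence "(\<lambda>N. (\<Sum>t<N. (of_bool (X (Suc t) \<omega>) - p_con) * 1) / real N + p_con) \<longlonglongrightarrow> p_con" by simp
    hence 1: "(\<lambda>N. (\<Sum>t<N. of_bool (X (Suc t) \<omega>)) / real N) \<longlonglongrightarrow> p_con"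
    proof (rule Lim_transform_eventually)
      show "\<forall>\<^sub>F N in sequentially. (\<Sum>t<N. (of_bool (X (Suc t) \<omega>) - p_con) * 1) / real N + p_con =
          (\<Sum>t<N. of_bool (X (Suc t) \<omega>)) / real N"
        by (rule eventually_sequentiallyI[of 1]) (simp add: sum_subtractf field_simps)
    qed
    have "(\<lambda>N. (\<Sum>t<N. (of_bool (X (Suc t) \<omega>) - p_con) * busy t \<omega>) / real N + p_con * ((\<Sum>t<N. busy t \<omega>) / real N))
        \<longlonglongrightarrow> 0 + p_con * busy_rate"
      by (intro tendsto_intros elim)
    also have "(\<lambda>N. (\<Sum>t<N. (of_bool (X (Suc t) \<omega>) - p_con) * busy t \<omega>) / real N + p_con * ((\<Sum>t<N. busy t \<omega>) / real N)) =
        (\<lambda>N. (\<Sum>t<N. of_bool (X (Suc t) \<omega>) * busy t \<omega>) / real N)"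
      by (rule ext) (simp add: left_diff_distrib sum_subtractf sum_distrib_left diff_divide_distrib)
    finally show ?case using elim 1 by simp
  qed
qed

lemma empty_after_request: "regular \<omega> \<Longrightarrow> X (Suc t) \<omega> \<Longrightarrow> F t \<omega> > 0 \<Longrightarrow> F (Suc t) \<omega> = 0"
  using F_step[of \<omega> "Suc t"] by (simp add: regular_def memory_step_def)

definition recurrent :: "'a \<Rightarrow> bool" where
  "recurrent \<omega> \<longleftrightarrow> infinite {t. t \<ge> 1 \<and> X t \<omega>} \<and> infinite {t. F t \<omega> = 0} \<and> infinite {t. F t \<omega> > 0}"

text \<open>Infinitely many zeros follow from infinitely many requests: each request finds the
  memory empty or empties it.\<close>

lemma AE_recurrent: "AE \<omega> in M. recurrent \<omega>"
  using AE_averages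
proof eventually_elim
  case (elim \<omega>)
  have "infinite {t. X (Suc t) \<omega>}"
    using infinite_if_average_pos[of "\<lambda>t. X (Suc t) \<omega>"] elim p_con by blast
  hence req: "infinite {t. t \<ge> 1 \<and> X t \<omega>}"
  proof (rule contrapos_nn)
    assume "finite {t. t \<ge> 1 \<and> X t \<omega>}"
    hence "finite (Suc -` {t. t \<ge> 1 \<and> X t \<omega>})" by (rule finite_vimageI) simp
    thus "finite {t. X (Suc t) \<omega>}" by (simp add: vimage_def)
  qed
  have pos: "infinite {t. F t \<omega> > 0}"
    using infinite_if_average_pos[of "\<lambda>t. F t \<omega> > 0"] elim busy_rate_pos
    unfolding busy_def by blast
  have "infinite {t. F t \<omega> = 0}"
    unfolding infinite_nat_iff_unbounded
  proof
    fix m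
    \<comment> \<open>The zero may occur one step before the request, hence
      \<open>m + 1\<close>.\<close>
    obtain t where t: "t > m + 1" "X t \<omega>" "t \<ge> 1" using req unfolding infinite_nat_iff_unbounded by blast
    then obtain s where s: "t = Suc s" by (cases t) auto
    show "\<exists>k>m. k \<in> {t. F t \<omega> = 0}"
    proof (cases "F s \<omega> = 0")
      case True thus ?thesis using t s by (intro exI[of _ s]) auto
    next
      case False
      hence "F s \<omega> > 0" using F_nonneg[of \<omega> s] elim by simp
      thus ?thesis using empty_after_request[of \<omega> s] elim t s by (intro exI[of _ t]) auto
    qed
  qed
  thus ?case using req pos by (simp add: recurrent_def)
qed

text \<open>Decoherence never empties the memory, so a request at \<open>Suc t\<close> is served iff
  \<open>busy t\<close> is 1; the request rate cancels in the quotient.\<close>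

lemma AE_served_fraction: "AE \<omega> in M. served_fraction \<Gamma> F X \<omega> \<longlonglongrightarrow> busy_rate"
  using AE_averages AE_recurrent
proof eventually_elim
  case (elim \<omega>)
  define f where "f t = (of_bool (F_minus \<Gamma> F t \<omega> > 0) :: real)" for t
  have f: "f (Suc t) = busy t \<omega>" for t
  proof (cases "F t \<omega> = 0")
    case True thus ?thesis by (simp add: f_def F_minus_def busy_def decohere_def)
  next
    case False
    hence F: "F t \<omega> \<in> {1/4..1}" using F_range[of \<omega> t] elim by auto
    have "F t \<omega> > 0" "decohere \<Gamma> (F t \<omega>) > 0" using F decohere_range[OF F] by auto
    thus ?thesis by (simp add: f_def F_minus_def busy_def)
  qed
  have "(\<lambda>m. 1 / real m * (\<Sum>j = 1..m. f (enumerate {t. t \<ge> 1 \<and> X t \<omega>} (j - 1)))) \<longlonglongrightarrow> p_con * busy_rate / p_con"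
    using elim p_con by (intro average_along_enumerate) (auto simp: f recurrent_def)
  thus ?case using p_con by (simp add: served_fraction_def[abs_def] T_con_def f_def)
qed

end

section \<open>Expected cycle lengths\<close>

context link_1GnB
begin

definition occ_in :: "nat \<Rightarrow> nat \<Rightarrow> 'a \<Rightarrow> real" where
  "occ_in i t \<omega> = of_bool (F t \<omega> > 0 \<and> cycle t \<omega> = i)"

definition empty_in :: "nat \<Rightarrow> nat \<Rightarrow> 'a \<Rightarrow> real" where
  "empty_in i t \<omega> = of_bool (F t \<omega> = 0 \<and> cycle t \<omega> = i)"

text \<open>The states from which cycle \<open>i\<close> can start. \<open>Suc\<close> in place of a
  subtraction makes this 0 for \<open>i = 0\<close>.\<close>

definition empty_before :: "nat \<Rightarrow> nat \<Rightarrow> 'a \<Rightarrow> real" where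
  "empty_before i t \<omega> = of_bool (F t \<omega> = 0 \<and> Suc (cycle t \<omega>) = i)"

lemma cycle_Suc: "cycle (Suc t) \<omega> = cycle t \<omega> + of_bool (F t \<omega> = 0 \<and> F (Suc t) \<omega> > 0)"
  by (simp add: cycle_def)

lemma measurable_cycle_indicators:
  "occ_in i t \<in> borel_measurable (field_of (past t))" "empty_in i t \<in> borel_measurable (field_of (past t))"
  "empty_before i t \<in> borel_measurable (field_of (past t))"
proof -
  note [measurable] = measurable_F_field[of t] measurable_cycle_field[of t]
  show "occ_in i t \<in> borel_measurable (field_of (past t))" unfolding occ_in_def of_bool_def by measurable
  show "empty_in i t \<in> borel_measurable (field_of (past t))" unfolding empty_in_def of_bool_def by measurable
  show "empty_before i t \<in> borel_measurable (field_of (past t))" unfolding empty_before_def of_bool_def by measurable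
qed

lemma cycle_indicators_measurable [measurable]:
  "occ_in i t \<in> borel_measurable M" "empty_in i t \<in> borel_measurable M" "empty_before i t \<in> borel_measurable M"
  by (rule measurable_from_field[OF measurable_cycle_indicators(1)] measurable_from_field[OF measurable_cycle_indicators(2)]
      measurable_from_field[OF measurable_cycle_indicators(3)]; auto)+

lemma integrable_cycle_indicators:
  "integrable M (occ_in i t)" "integrable M (empty_in i t)" "integrable M (empty_before i t)"
  by (rule integrable_const_bound[where B = 1]; auto simp: occ_in_def empty_in_def empty_before_def)+

lemma integrable_times_obs:
  assumes G: "G \<in> borel_measurable M" and b: "\<And>\<omega>. \<bar>G \<omega>\<bar> \<le> 1"
  shows "integrable M (\<lambda>\<omega>. G \<omega> * obs \<alpha> \<beta> (F t \<omega>))"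
proof (rule integrable_const_bound[where B = "\<bar>\<alpha>\<bar> + \<bar>\<beta>\<bar>"])
  show "AE \<omega> in M. norm (G \<omega> * obs \<alpha> \<beta> (F t \<omega>)) \<le> \<bar>\<alpha>\<bar> + \<bar>\<beta>\<bar>"
    using AE_regular
  proof eventually_elim
    case (elim \<omega>)
    have "\<bar>G \<omega>\<bar> * \<bar>obs \<alpha> \<beta> (F t \<omega>)\<bar> \<le> 1 * (\<bar>\<alpha>\<bar> + \<bar>\<beta>\<bar>)"
      using elim by (intro mult_mono b obs_bound) auto
    thus ?case by (simp add: abs_mult)
  qed
  show "(\<lambda>\<omega>. G \<omega> * obs \<alpha> \<beta> (F t \<omega>)) \<in> borel_measurable M"
    using G by measurable
qed

text \<open>Expected occupied time still ahead in cycle \<open>i\<close>, on the event that this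
  cycle is running at time \<open>t\<close>.\<close>

definition remaining_in :: "nat \<Rightarrow> nat \<Rightarrow> real" where
  "remaining_in i t = expectation (\<lambda>\<omega>. of_bool (cycle t \<omega> = i) * obs rem1 rem2 (F t \<omega>))"

text \<open>An occupied instant uses up one unit of the remaining time; a refill that starts cycle
  \<open>i\<close>, of probability \<open>1 - p_none\<close>, supplies
  \<open>mean_occ\<close>.\<close>

lemma remaining_in_Suc:
  "remaining_in i (Suc t) = remaining_in i t - expectation (occ_in i t)
     + (1 - p_none) * mean_occ * expectation (empty_before i t)"
proof -
  \<comment> \<open>Membership in cycle \<open>i\<close> at \<open>Suc t\<close> is not an event of
    the past, but it is one as soon as the memory is occupied then: the memory was occupied in cycle
    \<open>i\<close>, or empty in the cycle before.\<close>
  define G where "G \<omega> = occ_in i t \<omega> + empty_before i t \<omega>" for \<omega>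
  have G: "G \<in> borel_measurable (field_of (past t))"
    unfolding G_def by (intro borel_measurable_add measurable_cycle_indicators)
  have bG: "\<bar>G \<omega>\<bar> \<le> 1" for \<omega> by (auto simp: G_def occ_in_def empty_before_def)
  have GM [measurable]: "G \<in> borel_measurable M" unfolding G_def by measurable
  have "remaining_in i (Suc t) = expectation (\<lambda>\<omega>. G \<omega> * obs rem1 rem2 (F (Suc t) \<omega>))"
    unfolding remaining_in_def
  proof (rule integral_cong_AE)
    show "AE \<omega> in M. of_bool (cycle (Suc t) \<omega> = i) * obs rem1 rem2 (F (Suc t) \<omega>) = G \<omega> * obs rem1 rem2 (F (Suc t) \<omega>)"
      using AE_regular
    proof eventually_elim
      case (elim \<omega>)
      show ?case using F_nonneg[OF elim, of t]
        by (auto simp: cycle_Suc G_def occ_in_def empty_before_def obs_def)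
    qed
  qed (simp_all add: of_bool_def)
  also have "\<dots> = expectation (\<lambda>\<omega>. G \<omega> * next_obs rem1 rem2 (F t \<omega>))"
    by (rule expectation_step[OF G]) (use bG in auto)
  also have "\<dots> = expectation (\<lambda>\<omega>. of_bool (cycle t \<omega> = i) * obs rem1 rem2 (F t \<omega>) - occ_in i t \<omega>
      + (1 - p_none) * mean_occ * empty_before i t \<omega>)"
  proof (rule integral_cong_AE)
    show "AE \<omega> in M. G \<omega> * next_obs rem1 rem2 (F t \<omega>) = of_bool (cycle t \<omega> = i) * obs rem1 rem2 (F t \<omega>) - occ_in i t \<omega>
      + (1 - p_none) * mean_occ * empty_before i t \<omega>"
      using AE_regular
    proof eventually_elim
      case (elim \<omega>)
      show ?case using F_nonneg[OF elim, of t] next_obs_rem[of 1 "F t \<omega>"]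
        by (auto simp: G_def occ_in_def empty_before_def obs_def)
    qed
  qed (simp_all add: of_bool_def)
  also have "\<dots> = remaining_in i t - expectation (occ_in i t) + (1 - p_none) * mean_occ * expectation (empty_before i t)"
  proof -
    have "integrable M (\<lambda>\<omega>. of_bool (cycle t \<omega> = i) * obs rem1 rem2 (F t \<omega>))"
      by (rule integrable_times_obs) (simp_all add: of_bool_def)
    thus ?thesis using integrable_cycle_indicators unfolding remaining_in_def by simp
  qed
  finally show ?thesis .
qed

definition prob_cycle :: "nat \<Rightarrow> nat \<Rightarrow> real" where
  "prob_cycle i t = expectation (\<lambda>\<omega>. of_bool (cycle t \<omega> = i))"

lemma prob_cycle_Suc:
  "prob_cycle i (Suc t) = prob_cycle i t - (1 - p_none) * expectation (empty_in i t)
     + (1 - p_none) * expectation (empty_before i t)"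
proof -
  define G where "G \<omega> = empty_before i t \<omega> - empty_in i t \<omega>" for \<omega>
  have G: "G \<in> borel_measurable (field_of (past t))"
    unfolding G_def by (intro borel_measurable_diff measurable_cycle_indicators)
  have bG: "\<bar>G \<omega>\<bar> \<le> 1" for \<omega> by (auto simp: G_def empty_in_def empty_before_def)
  have GM [measurable]: "G \<in> borel_measurable M" unfolding G_def by measurable
  \<comment> \<open>\<open>obs 1 0\<close> indicates occupancy. The cycle number changes only when
    an empty memory is refilled, and the sign of \<open>G\<close> tells whether this enters or
    leaves cycle \<open>i\<close>.\<close>
  have "of_bool (cycle (Suc t) \<omega> = i) = (of_bool (cycle t \<omega> = i) + G \<omega> * obs 1 0 (F (Suc t) \<omega>) :: real)" for \<omega>
    by (auto simp: cycle_Suc G_def empty_in_def empty_before_def obs_def)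
  hence "prob_cycle i (Suc t) = expectation (\<lambda>\<omega>. of_bool (cycle t \<omega> = i) + G \<omega> * obs 1 0 (F (Suc t) \<omega>))"
    by (simp add: prob_cycle_def)
  also have "\<dots> = prob_cycle i t + expectation (\<lambda>\<omega>. G \<omega> * obs 1 0 (F (Suc t) \<omega>))"
    unfolding prob_cycle_def
    by (intro Bochner_Integration.integral_add integrable_times_obs GM bG integrable_const_bound[where B = 1])
       (simp_all add: of_bool_def)
  also have "expectation (\<lambda>\<omega>. G \<omega> * obs 1 0 (F (Suc t) \<omega>)) = expectation (\<lambda>\<omega>. G \<omega> * next_obs 1 0 (F t \<omega>))"
    by (rule expectation_step[OF G]) (use bG in auto)
  also have "(\<lambda>\<omega>. G \<omega> * next_obs 1 0 (F t \<omega>)) = (\<lambda>\<omega>. (1 - p_none) * empty_before i t \<omega> - (1 - p_none) * empty_in i t \<omega>)"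
    by (auto simp: G_def empty_in_def empty_before_def next_obs_def)
  finally show ?thesis using integrable_cycle_indicators by simp
qed

lemma prob_cycle_split: "prob_cycle i t = expectation (occ_in i t) + expectation (empty_in i t)"
proof -
  have "prob_cycle i t = expectation (\<lambda>\<omega>. occ_in i t \<omega> + empty_in i t \<omega>)"
    unfolding prob_cycle_def
  proof (rule integral_cong_AE)
    show "AE \<omega> in M. of_bool (cycle t \<omega> = i) = occ_in i t \<omega> + empty_in i t \<omega>"
      using AE_regular
    proof eventually_elim
      case (elim \<omega>)
      show ?case using F_nonneg[OF elim, of t] by (auto simp: occ_in_def empty_in_def)
    qed
  qed (simp_all add: of_bool_def)
  thus ?thesis using integrable_cycle_indicators by simp
qed

lemma remaining_in_bound: "\<bar>remaining_in i t\<bar> \<le> (\<bar>rem1\<bar> + \<bar>rem2\<bar>) * expectation (occ_in i t)"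
proof -
  have "integrable M (\<lambda>\<omega>. of_bool (cycle t \<omega> = i) * obs rem1 rem2 (F t \<omega>))"
    by (rule integrable_times_obs) (simp_all add: of_bool_def)
  hence "\<bar>remaining_in i t\<bar> \<le> expectation (\<lambda>\<omega>. \<bar>of_bool (cycle t \<omega> = i) * obs rem1 rem2 (F t \<omega>)\<bar>)"
    unfolding remaining_in_def by (intro integral_abs_bound)
  also have "\<dots> \<le> expectation (\<lambda>\<omega>. (\<bar>rem1\<bar> + \<bar>rem2\<bar>) * occ_in i t \<omega>)"
  proof (rule integral_mono_AE)
    show "integrable M (\<lambda>\<omega>. \<bar>of_bool (cycle t \<omega> = i) * obs rem1 rem2 (F t \<omega>)\<bar>)"
      by (intro integrable_abs integrable_times_obs) (simp_all add: of_bool_def)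
    show "AE \<omega> in M. \<bar>of_bool (cycle t \<omega> = i) * obs rem1 rem2 (F t \<omega>)\<bar> \<le> (\<bar>rem1\<bar> + \<bar>rem2\<bar>) * occ_in i t \<omega>"
      using AE_regular
    proof eventually_elim
      case (elim \<omega>)
      show ?case using obs_bound[OF elim, of rem1 rem2 t] by (auto simp: occ_in_def obs_def)
    qed
  qed (use integrable_cycle_indicators in auto)
  finally show ?thesis by simp
qed

lemma expectation_occ_in_bounds: "0 \<le> expectation (occ_in i t)" "expectation (occ_in i t) \<le> 1"
proof -
  show "0 \<le> expectation (occ_in i t)" by (intro integral_nonneg_AE) (simp add: occ_in_def)
  have "expectation (occ_in i t) \<le> expectation (\<lambda>_. 1)"
    by (intro integral_mono integrable_cycle_indicators) (auto simp: occ_in_def)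
  thus "expectation (occ_in i t) \<le> 1" by (simp add: prob_space)
qed

lemma expectation_empty_in_nonneg: "0 \<le> expectation (empty_in i t)"
  by (intro integral_nonneg_AE) (simp add: empty_in_def)

lemma prob_cycle_bound: "\<bar>prob_cycle i t\<bar> \<le> 1"
proof -
  have "0 \<le> prob_cycle i t" unfolding prob_cycle_def by (intro integral_nonneg_AE) simp
  moreover have "prob_cycle i t \<le> expectation (\<lambda>_. 1)" unfolding prob_cycle_def
    by (intro integral_mono integrable_const_bound[where B = 1]) (auto simp: of_bool_def)
  ultimately show ?thesis by (simp add: prob_space)
qed

lemma remaining_in_0: "remaining_in i 0 = of_bool (i = 0) * mean_occ"
proof -
  have "remaining_in i 0 = expectation (\<lambda>\<omega>. of_bool (i = 0) * obs rem1 rem2 F_new)"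
    unfolding remaining_in_def by (intro Bochner_Integration.integral_cong) (auto simp: F_0 cycle_def)
  also have "obs rem1 rem2 F_new = mean_occ"
    using F_new rem_eqs(3) by (simp add: obs_def)
  finally show ?thesis by (simp add: prob_space)
qed

lemma prob_cycle_0: "prob_cycle i 0 = of_bool (i = 0)"
  by (auto simp: prob_cycle_def cycle_def prob_space)

text \<open>Bounded stocks give summability; hence the terms, and with them
  \<open>remaining_in\<close> and \<open>prob_cycle\<close>, tend to 0, and the telescoping sums can
  be evaluated. Cycle 0 is fed by the initial state; a later cycle starts at 0 and receives a total
  refill probability of (1 - p_none) / (1 - p_none) = 1.\<close>

lemma cycle_sums_step:
  assumes before: "summable (\<lambda>t. expectation (empty_before i t))"
    "(\<Sum>t. expectation (empty_before i t)) = of_bool (i \<noteq> 0) / (1 - p_none)"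
  shows "summable (\<lambda>t. expectation (occ_in i t)) \<and> (\<Sum>t. expectation (occ_in i t)) = mean_occ
   \<and> summable (\<lambda>t. expectation (empty_in i t)) \<and> (\<Sum>t. expectation (empty_in i t)) = 1 / (1 - p_none)"
proof -
  have g: "1 - p_none > 0" using p_none by simp
  have "\<bar>remaining_in i t\<bar> \<le> \<bar>rem1\<bar> + \<bar>rem2\<bar>" for t
    using remaining_in_bound[of i t] mult_left_mono[OF expectation_occ_in_bounds(2)[of i t], of "\<bar>rem1\<bar> + \<bar>rem2\<bar>"]
    by simp
  hence su: "summable (\<lambda>t. expectation (occ_in i t))"
    by (rule summable_telescoping[OF remaining_in_Suc expectation_occ_in_bounds(1) _ summable_mult[OF before(1)]])
  have sge: "summable (\<lambda>t. (1 - p_none) * expectation (empty_in i t))"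
    by (rule summable_telescoping[OF prob_cycle_Suc _ prob_cycle_bound summable_mult[OF before(1)]])
       (use expectation_empty_in_nonneg g in simp)
  hence se: "summable (\<lambda>t. expectation (empty_in i t))"
    using g by (subst (asm) summable_cmult_iff) auto
  have u0: "(\<lambda>t. expectation (occ_in i t)) \<longlonglongrightarrow> 0" by (rule summable_LIMSEQ_zero[OF su])
  have "(\<lambda>t. expectation (occ_in i t) + expectation (empty_in i t)) \<longlonglongrightarrow> 0 + 0"
    by (intro tendsto_add u0 summable_LIMSEQ_zero[OF se])
  hence r0: "prob_cycle i \<longlonglongrightarrow> 0" by (simp add: prob_cycle_split[abs_def])
  have y0: "remaining_in i \<longlonglongrightarrow> 0"
  proof (rule Lim_null_comparison)
    show "\<forall>\<^sub>F t in sequentially. norm (remaining_in i t) \<le> (\<bar>rem1\<bar> + \<bar>rem2\<bar>) * expectation (occ_in i t)"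
      using remaining_in_bound by simp
    show "(\<lambda>t. (\<bar>rem1\<bar> + \<bar>rem2\<bar>) * expectation (occ_in i t)) \<longlonglongrightarrow> 0"
      using tendsto_mult_right_zero[OF u0] by simp
  qed
  have "(\<Sum>t. expectation (occ_in i t)) = mean_occ"
    using suminf_telescoping[OF remaining_in_Suc y0 summable_mult[OF before(1)]] g
    unfolding remaining_in_0 suminf_mult[OF before(1)] before(2) by (cases "i = 0") simp_all
  moreover have "(1 - p_none) * (\<Sum>t. expectation (empty_in i t)) = 1"
    using suminf_telescoping[OF prob_cycle_Suc r0 summable_mult[OF before(1)]] g
    unfolding prob_cycle_0 suminf_mult[OF before(1)] suminf_mult[OF se] before(2) by (cases "i = 0") simp_all
  ultimately show ?thesis using su se g by (simp add: field_simps)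
qed

lemma expectation_cycle_sums:
  "summable (\<lambda>t. expectation (occ_in i t)) \<and> (\<Sum>t. expectation (occ_in i t)) = mean_occ
   \<and> summable (\<lambda>t. expectation (empty_in i t)) \<and> (\<Sum>t. expectation (empty_in i t)) = 1 / (1 - p_none)"
proof (induction i)
  case 0
  have "empty_before 0 t = (\<lambda>_. 0)" for t by (auto simp: empty_before_def)
  thus ?case by (intro cycle_sums_step) simp_all
next
  case (Suc i)
  have "empty_before (Suc i) t = empty_in i t" for t by (auto simp: empty_before_def empty_in_def)
  thus ?case using Suc by (intro cycle_sums_step) simp_all
qed

lemma path_sums:
  assumes "regular \<omega>" "recurrent \<omega>"
  shows "(\<lambda>t. occ_in i t \<omega>) sums real (T_occ F i \<omega>)" "(\<lambda>t. empty_in i t \<omega>) sums real (T_gen F i \<omega>)"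
proof -
  have s: "F 0 \<omega> > 0" using assms(1) F_0 F_new by (simp add: regular_def)
  have z: "infinite {t. F t \<omega> = 0}" "infinite {t. F t \<omega> > 0}" using assms(2) by (simp_all add: recurrent_def)
  show "(\<lambda>t. occ_in i t \<omega>) sums real (T_occ F i \<omega>)"
    using occupied_sums[of "\<lambda>t. F t \<omega>" i, OF F_nonneg[OF assms(1)] s z]
    by (simp only: occ_in_def T_occ_def cycle_def)
  show "(\<lambda>t. empty_in i t \<omega>) sums real (T_gen F i \<omega>)"
    using empty_sums[of "\<lambda>t. F t \<omega>" i, OF F_nonneg[OF assms(1)] s z]
    by (simp only: empty_in_def T_gen_def cycle_def)
qed

lemma occupied_at_measurable [measurable]:
  "(\<lambda>\<omega>. occupied_at (\<lambda>t. F t \<omega>) i) \<in> measurable M (count_space UNIV)"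
proof (induction i)
  case (Suc i)
  note [measurable] = Suc
  show ?case unfolding occupied_at.simps next_time_def by measurable
qed simp

lemma emptied_at_measurable [measurable]:
  "(\<lambda>\<omega>. emptied_at (\<lambda>t. F t \<omega>) i) \<in> measurable M (count_space UNIV)"
  unfolding emptied_at_def next_time_def by measurable

text \<open>Termwise integration of a nonnegative series. The series equals \<open>T\<close> only
  almost surely, so measurability of \<open>T\<close> enters as a premise.\<close>

lemma integral_of_sums:
  fixes T :: "'a \<Rightarrow> real"
  assumes T: "T \<in> borel_measurable M" and f: "\<And>t. integrable M (f t)" and nonneg: "\<And>t \<omega>. 0 \<le> f t \<omega>"
    and sums: "AE \<omega> in M. (\<lambda>t. f t \<omega>) sums T \<omega>" and sm: "summable (\<lambda>t. expectation (f t))"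
  shows "integrable M T \<and> expectation T = (\<Sum>t. expectation (f t))"
proof -
  have 1: "AE \<omega> in M. summable (\<lambda>t. norm (f t \<omega>))"
    using sums by eventually_elim (use nonneg in \<open>auto simp: sums_iff\<close>)
  have 2: "summable (\<lambda>t. expectation (\<lambda>\<omega>. norm (f t \<omega>)))"
    using sm nonneg by simp
  have eq: "AE \<omega> in M. (\<Sum>t. f t \<omega>) = T \<omega>" using sums by eventually_elim (simp add: sums_iff)
  have m: "(\<lambda>\<omega>. \<Sum>t. f t \<omega>) \<in> borel_measurable M"
    using f by (intro borel_measurable_suminf) auto
  have "integrable M T"
    using integrable_suminf[OF f 1 2] integrable_cong_AE[OF m T eq] by simp
  moreover have "expectation T = (\<Sum>t. expectation (f t))"
    using integral_suminf[OF f 1 2] integral_cong_AE[OF m T eq] by simp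
  ultimately show ?thesis by blast
qed

lemma expectation_T_occ: "integrable M (\<lambda>\<omega>. real (T_occ F i \<omega>)) \<and> expectation (\<lambda>\<omega>. real (T_occ F i \<omega>)) = mean_occ"
proof -
  have "(\<lambda>\<omega>. real (T_occ F i \<omega>)) \<in> borel_measurable M" unfolding T_occ_def by measurable
  moreover have "AE \<omega> in M. (\<lambda>t. occ_in i t \<omega>) sums real (T_occ F i \<omega>)"
    using AE_regular AE_recurrent by eventually_elim (rule path_sums)
  ultimately show ?thesis
    using integral_of_sums[of "\<lambda>\<omega>. real (T_occ F i \<omega>)" "occ_in i"] expectation_cycle_sums[of i]
      integrable_cycle_indicators by (simp add: occ_in_def)
qed

lemma expectation_T_gen: "integrable M (\<lambda>\<omega>. real (T_gen F i \<omega>)) \<and> expectation (\<lambda>\<omega>. real (T_gen F i \<omega>)) = 1 / (1 - p_none)"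
proof -
  have "(\<lambda>\<omega>. real (T_gen F i \<omega>)) \<in> borel_measurable M" unfolding T_gen_def by measurable
  moreover have "AE \<omega> in M. (\<lambda>t. empty_in i t \<omega>) sums real (T_gen F i \<omega>)"
    using AE_regular AE_recurrent by eventually_elim (rule path_sums)
  ultimately show ?thesis
    using integral_of_sums[of "\<lambda>\<omega>. real (T_gen F i \<omega>)" "empty_in i"] expectation_cycle_sums[of i]
      integrable_cycle_indicators by (simp add: empty_in_def)
qed

text \<open>From fidelity z + 1/4, the next disturbance is a successful purification with
  probability D' + C' z, and B' + A' z is the mean of the new z on that event: after j undisturbed
  steps, of probability \<open>p_stay ^ j\<close>, z has shrunk by e^(-j \<Gamma>), and geometric
  series in j give the denominators. Undoing them takes P' = 1 - \<open>p_stay\<close> out of one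
  column of identity minus the step matrix and e^(-\<Gamma>) (e^\<Gamma> - \<open>p_stay\<close>)
  out of the other. The second factor cancels against the numerator; 1/P' remains, the mean time to
  a disturbance.\<close>

lemma mean_occ_formula:
  assumes P: "P' = p_con + q * (1 - (1 - p_gen) ^ n) * (1 - p_con)"
    and A: "A' = q * (1 - p_con) * binomial_average n p_gen a /
              (exp \<Gamma> - (1 - q + q * (1 - p_gen) ^ n) * (1 - p_con))"
    and B: "B' = q * (1 - p_con) * binomial_average n p_gen b /
              (p_con + q * (1 - (1 - p_gen) ^ n) * (1 - p_con))"
    and C: "C' = q * (1 - p_con) * binomial_average n p_gen c /
              (exp \<Gamma> - (1 - q + q * (1 - p_gen) ^ n) * (1 - p_con))"
    and D: "D' = q * (1 - p_con) * binomial_average n p_gen d /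
              (p_con + q * (1 - (1 - p_gen) ^ n) * (1 - p_con))"
  shows "mean_occ = (1 - A' + C' * (F_new - 1/4)) / (((1 - A') * (1 - D') - B' * C') * P')"
proof -
  define E where "E = exp \<Gamma> - p_stay"
  have P': "P' = 1 - p_stay" unfolding P p_stay_def p_none_def by (simp add: algebra_simps)
  have stay: "p_stay < 1"
    using p_stay_plus_p_try p_stay_try_nonneg(2) p_none p_con
    by (smt (verit) mult_nonneg_nonneg)
  have Epos: "E > 0" using stay \<Gamma> one_le_exp_iff[of \<Gamma>] unfolding E_def by linarith
  have Ppos: "P' > 0" using stay P' by simp
  have A': "A' * E = p_try * binomial_average n p_gen a"
    using Epos unfolding A E_def p_stay_def p_none_def p_try_def by simp
  have C': "C' * E = p_try * binomial_average n p_gen c"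
    using Epos unfolding C E_def p_stay_def p_none_def p_try_def by simp
  have B': "B' * P' = p_try * binomial_average n p_gen b"
    using Ppos unfolding B P[symmetric] p_try_def by simp
  have D': "D' * P' = p_try * binomial_average n p_gen d"
    using Ppos unfolding D P[symmetric] p_try_def by simp
  define e where "e = exp (- \<Gamma>)"
  have ee: "e * exp \<Gamma> = 1" by (simp add: e_def exp_minus)
  have "e * E = 1 - e * p_stay" by (simp add: E_def right_diff_distrib ee)
  hence m22: "1 - m22 = (e * E) * (1 - A')"
    unfolding m22_def A'[symmetric] e_def[symmetric] by (simp add: algebra_simps)
  have m12: "m12 = (e * E) * C'" unfolding m12_def C'[symmetric] e_def[symmetric] by simp
  have m11: "1 - m11 = P' * (1 - D')" unfolding m11_def D'[symmetric] by (simp add: P' algebra_simps)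
  have m21: "m21 = P' * B'" unfolding m21_def B'[symmetric] by simp
  have num: "1 - m22 + m12 * (F_new - 1/4) = (e * E) * (1 - A' + C' * (F_new - 1/4))"
    unfolding m22 m12 by (simp add: algebra_simps)
  have det: "m_det = (e * E) * (((1 - A') * (1 - D') - B' * C') * P')"
    unfolding m_det_def m22 m12 m11 m21 by (simp add: algebra_simps)
  have "e * E \<noteq> 0" using Epos by (simp add: e_def)
  thus ?thesis unfolding mean_occ_def num det by (rule mult_divide_mult_cancel_left)
qed

end

theorem theorem1:
  fixes M :: "'a measure" and n i :: nat and p_gen p_con q \<Gamma> F_new :: real
    and a b c d :: "nat \<Rightarrow> real"
    and X Q :: "nat \<Rightarrow> 'a \<Rightarrow> bool" and K :: "nat \<Rightarrow> 'a \<Rightarrow> nat" and W F :: "nat \<Rightarrow> 'a \<Rightarrow> real"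
    and A' B' C' D' P' :: real
  assumes "link_1GnB M n p_gen p_con q \<Gamma> F_new a b c d X K Q W F"
    and "P' = p_con + q * (1 - (1 - p_gen) ^ n) * (1 - p_con)"
    and "A' = q * (1 - p_con) * binomial_average n p_gen a /
              (exp \<Gamma> - (1 - q + q * (1 - p_gen) ^ n) * (1 - p_con))"
    and "B' = q * (1 - p_con) * binomial_average n p_gen b /
              (p_con + q * (1 - (1 - p_gen) ^ n) * (1 - p_con))"
    and "C' = q * (1 - p_con) * binomial_average n p_gen c /
              (exp \<Gamma> - (1 - q + q * (1 - p_gen) ^ n) * (1 - p_con))"
    and "D' = q * (1 - p_con) * binomial_average n p_gen d /
              (p_con + q * (1 - (1 - p_gen) ^ n) * (1 - p_con))"
  shows "(AE \<omega> in M. infinite {t. t \<ge> 1 \<and> X t \<omega>} \<and> infinite {t. F t \<omega> = 0} \<and> infinite {t. F t \<omega> > 0})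
    \<and> (AE \<omega> in M. convergent (served_fraction \<Gamma> F X \<omega>) \<and>
         availability \<Gamma> F X \<omega> =
           (\<integral>\<omega>'. real (T_occ F i \<omega>') \<partial>M) /
           ((\<integral>\<omega>'. real (T_gen F i \<omega>') \<partial>M) + (\<integral>\<omega>'. real (T_occ F i \<omega>') \<partial>M)))
    \<and> integrable M (\<lambda>\<omega>. real (T_gen F i \<omega>))
    \<and> (\<integral>\<omega>. real (T_gen F i \<omega>) \<partial>M) = 1 / (1 - (1 - p_gen) ^ n)
    \<and> integrable M (\<lambda>\<omega>. real (T_occ F i \<omega>))
    \<and> (\<integral>\<omega>. real (T_occ F i \<omega>) \<partial>M) =
         (1 - A' + C' * (F_new - 1/4)) / (((1 - A') * (1 - D') - B' * C') * P')"
proof -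
  interpret link_1GnB M n p_gen p_con q \<Gamma> F_new a b c d X K Q W F by fact
  have occ: "integrable M (\<lambda>\<omega>. real (T_occ F i \<omega>))" "expectation (\<lambda>\<omega>. real (T_occ F i \<omega>)) = mean_occ"
    and gen: "integrable M (\<lambda>\<omega>. real (T_gen F i \<omega>))" "expectation (\<lambda>\<omega>. real (T_gen F i \<omega>)) = 1 / (1 - p_none)"
    using expectation_T_occ[of i] expectation_T_gen[of i] by auto
  \<comment> \<open>Recurrence gives meaning to the other claims: \<open>LEAST\<close> and
    \<open>enumerate\<close> in the cycle and request times return the intended values when these
    sets are infinite.\<close>
  have "AE \<omega> in M. infinite {t. t \<ge> 1 \<and> X t \<omega>} \<and> infinite {t. F t \<omega> = 0} \<and> infinite {t. F t \<omega> > 0}"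
    using AE_recurrent by (simp add: recurrent_def)
  moreover have "AE \<omega> in M. convergent (served_fraction \<Gamma> F X \<omega>) \<and>
      availability \<Gamma> F X \<omega> = mean_occ / (1 / (1 - p_none) + mean_occ)"
    using AE_served_fraction
  proof eventually_elim
    case (elim \<omega>)
    thus ?case unfolding availability_def busy_rate_def[symmetric]
      by (auto simp: convergent_def intro: limI)
  qed
  moreover note mean_occ_formula[OF assms(2-6)]
  ultimately show ?thesis
    using occ(1) gen(1) unfolding occ(2) gen(2) by (simp add: p_none_def)
qed

end
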